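(* Let $p$ be a prime, let $G$ be an abelian $p$-group and let $L$ be a large subgroup of $G$. Then $G$ is $\sigma$-summable if and only if $L$ is $\sigma$-summable.
   Context: All groups are abelian and written additively. A subgroup $L$ of an abelian $p$-group $G$ is large if $L$ is fully invariant in $G$ (i.e. $f(L)\subseteq L$ for every endomorphism $f$ of $G$) and $G=L+B$ for every basic subgroup $B$ of $G$. For ordinals, $p^0G=G$, $p^{\alpha+1}G=p(p^\alpha G)$ and $p^\alpha G=\bigcap_{\beta<\alpha}p^\beta G$ for limit $\alpha$; the length of $G$ is the least ordinal $\lambda$ with $p^{\lambda}G=p^{\lambda+1}G$. $G[p]=\{g\in G: pg=0\}$. An abelian $p$-group $C$ is $\sigma$-summable if $C[p]=\bigcup_{n<\omega}C_n$ for some subgroups $C_n\subseteq C_{n+1}$ of $C[p]$ such that for every $n$ there is an ordinal $\alpha_n<\operatorname{length}(C)$ with $C_n\cap p^{\alpha_n}C=0$. *)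

theory Defs
  imports "HOL-Algebra.Algebra" "HOL-Computational_Algebra.Primes"
begin

section \<open>Ordinals\<close>

text \<open>
  The type \<open>'a ordinal\<close> consists of the order types of well-orders of subsets of \<open>'a + nat\<close>, i.e.
  of all ordinals of cardinality at most \<open>max |'a| \<aleph>\<^sub>0\<close>: an initial segment of the ordinals. It has no greatest element, and it does not
  embed into \<open>'a\<close>. Hence every descending sequence of subsets of \<open>'a\<close> indexed by it becomes
  stationary (see \<open>ex_stationary\<close>): nothing is lost by using it in place of the class of all ordinals
  to index the subgroups \<open>p\<^sup>\<alpha>G\<close> of a group with elements in \<open>'a\<close>.
\<close>

quotient_type 'a ordinal = "('a + nat) rel" / partial: "\<lambda>r s. r =o s"
proof (rule part_equivpI)
  show "\<exists>r :: ('a + nat) rel. r =o r"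
    by (rule exI[of _ "{}"], rule ordIso_reflexive) simp
  show "symp (\<lambda>r s :: ('a + nat) rel. r =o s)"
    by (rule sympI) (rule ordIso_symmetric)
  show "transp (\<lambda>r s :: ('a + nat) rel. r =o s)"
    by (rule transpI) (erule ordIso_transitive)
qed

abbreviation otype :: "('a + nat) rel \<Rightarrow> 'a ordinal"
  where "otype \<equiv> abs_ordinal"

lemma otype_surj: obtains r where "Well_order r" "x = otype r"
proof
  show "Well_order (rep_ordinal x)"
    using Quotient_rep_reflp[OF Quotient_ordinal, of x]
    unfolding ordIso_def mem_Collect_eq case_prod_conv by (rule conjunct1)
  show "x = otype (rep_ordinal x)"
    by (rule Quotient_abs_rep[OF Quotient_ordinal, symmetric])
qed

lemma otype_eq_iff: "Well_order r \<Longrightarrow> Well_order s \<Longrightarrow> otype r = otype s \<longleftrightarrow> r =o s"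
  using Quotient_rel[OF Quotient_ordinal, of r s] ordIso_reflexive[of r] ordIso_reflexive[of s] by argo

instantiation ordinal :: (type) linorder
begin

lift_definition less_eq_ordinal :: "'a ordinal \<Rightarrow> 'a ordinal \<Rightarrow> bool" is "\<lambda>r s. r \<le>o s"
  by (meson ordIso_ordLeq_trans ordLeq_ordIso_trans ordIso_symmetric)

lift_definition less_ordinal :: "'a ordinal \<Rightarrow> 'a ordinal \<Rightarrow> bool" is "\<lambda>r s. r <o s"
  by (meson ordIso_ordLess_trans ordLess_ordIso_trans ordIso_symmetric)

lemma otype_le_iff: "Well_order r \<Longrightarrow> Well_order s \<Longrightarrow> otype r \<le> otype s \<longleftrightarrow> r \<le>o s"
  by (rule less_eq_ordinal.abs_eq) (rule ordIso_reflexive, assumption)+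

lemma otype_less_iff: "Well_order r \<Longrightarrow> Well_order s \<Longrightarrow> otype r < otype s \<longleftrightarrow> r <o s"
  by (rule less_ordinal.abs_eq) (rule ordIso_reflexive, assumption)+

instance
proof
  fix x y z :: "'a ordinal"
  obtain r where r: "Well_order r" "x = otype r" by (rule otype_surj)
  obtain s where s: "Well_order s" "y = otype s" by (rule otype_surj)
  obtain t where t: "Well_order t" "z = otype t" by (rule otype_surj)
  note wo = r(1) s(1) t(1) and eq = r(2) s(2) t(2)
  note iffs = eq otype_eq_iff[OF wo(1,2)] otype_less_iff[OF wo(1,2)] otype_le_iff[OF wo(1,2)]
    otype_le_iff[OF wo(2,1)] otype_le_iff[OF wo(1,1)] otype_le_iff[OF wo(2,3)] otype_le_iff[OF wo(1,3)]
  show "x < y \<longleftrightarrow> x \<le> y \<and> \<not> y \<le> x"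
    unfolding iffs using not_ordLeq_iff_ordLess[OF wo(1,2)] ordLess_imp_ordLeq[of r s] by argo
  show "x \<le> x"
    unfolding iffs using wo(1) by (rule ordLeq_reflexive)
  show "x \<le> z" if "x \<le> y" "y \<le> z"
    using that unfolding iffs by (rule ordLeq_transitive)
  show "x = y" if "x \<le> y" "y \<le> x"
    using that unfolding iffs ordIso_iff_ordLeq by (rule conjI)
  show "x \<le> y \<or> y \<le> x"
    unfolding iffs using wo(1,2) by (rule ordLeq_total)
qed

end

instance ordinal :: (type) wellorder
proof (rule wf_wellorderI)
  have "{(x :: 'a ordinal, y). x < y} = inv_image ordLess rep_ordinal"
    by (auto simp: inv_image_def less_ordinal.rep_eq)
  then show "wf {(x :: 'a ordinal, y). x < y}"
    by (simp add: wf_inv_image wf_ordLess)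
qed intro_classes

lemma ordinal_no_embedding: "\<not> inj (h :: 'a ordinal \<Rightarrow> 'a + nat)"
proof
  assume h: "inj h"
  define R where "R = {(x :: 'a ordinal, y). x \<le> y}"
  have FR: "Field R = UNIV" by (auto simp: R_def Field_def)
  have "refl_on UNIV R" "trans R" "antisym R" "total_on UNIV R"
    unfolding R_def refl_on_def trans_def antisym_def total_on_def by auto
  moreover have "R - Id = {(x, y). x < y}" by (auto simp: R_def)
  then have "wf (R - Id)" by (simp only: wf)
  ultimately have wR: "Well_order R"
    unfolding FR well_order_on_def linear_order_on_def partial_order_on_def preorder_on_def
    by simp
  define r where "r = dir_image R h"
  have wr: "Well_order r"
    unfolding r_def using wR h by (intro Well_order_dir_image) (auto intro: inj_on_subset)
  have Fr: "Field r = range h" by (simp add: r_def dir_image_Field FR)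
  have r_iff: "(h x, h y) \<in> r \<longleftrightarrow> x \<le> y" for x y
    using h by (auto simp: r_def dir_image_def R_def inj_eq)
  define g where "g = (\<lambda>x. otype (Restr r (underS r (h x))))"
  have wg: "Well_order (Restr r (underS r (h x)))" for x
    by (rule Well_order_Restr[OF wr])
  have g_less: "g x < otype r" for x
    unfolding g_def using wg wr Fr underS_Restr_ordLess[OF wr, of "h x"]
    by (simp add: otype_less_iff)
  have g_mono: "g x < g y" if "x < y" for x y
  proof -
    let ?s = "Restr r (underS r (h y))"
    have U: "underS r (h z) = h ` {..<z}" for z
    proof -
      have "a \<in> range h" if "(a, h z) \<in> r" for a
        using that Fr by (metis FieldI1)
      then have "underS r (h z) = {a \<in> range h. a \<noteq> h z \<and> (a, h z) \<in> r}"
        by (auto simp: underS_def)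
      also have "\<dots> = h ` {..<z}"
        using h by (auto simp: r_iff inj_eq)
      finally show ?thesis .
    qed
    have sub: "h ` {..<x} \<subseteq> h ` {..<y}" using that by (auto intro: order.strict_trans)
    have hx: "h x \<in> h ` {..<y}" using that by simp
    then have "(h x, h x) \<in> ?s"
      unfolding U by (simp add: r_iff)
    then have Fs: "h x \<in> Field ?s"
      by (rule FieldI1)
    have "underS ?s (h x) = underS r (h x) \<inter> h ` {..<y}"
      using hx unfolding U[of y] by (auto simp: underS_def)
    then have "underS ?s (h x) = h ` {..<x}"
      using sub unfolding U by blast
    then have "Restr ?s (underS ?s (h x)) = Restr r (underS r (h x))"
      using sub unfolding U by blast
    moreover have "Restr ?s (underS ?s (h x)) <o ?s"
      using Fs wg by (intro underS_Restr_ordLess) auto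
    ultimately show ?thesis unfolding g_def using wg by (simp add: otype_less_iff)
  qed
  have "x \<le> g x" for x
  proof (induction x rule: less_induct)
    case (less x)
    show ?case
    proof (rule ccontr)
      assume "\<not> x \<le> g x"
      then have "g x < x" by simp
      with g_mono[OF this] less.IH[OF this] show False by simp
    qed
  qed
  with g_less[of "otype r"] show False by (simp add: leD)
qed

lemma ordinal_ex_greater: "\<exists>y. x < (y :: 'a ordinal)"
proof (rule ccontr)
  assume "\<not> ?thesis"
  then have top: "y \<le> x" for y by (meson not_le)
  obtain r where r: "Well_order r" "x = otype r" by (rule otype_surj)
  have "\<exists>a. y = otype (Restr r (underS r a))" if "y < x" for y
  proof -
    obtain s where s: "Well_order s" "y = otype s" by (rule otype_surj)
    with that r have "s <o r" by (simp add: otype_less_iff)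
    with r s obtain a where "s =o Restr r (underS r a)"
      using ordLess_iff_ordIso_Restr by blast
    with r s show ?thesis by (metis otype_eq_iff Well_order_Restr)
  qed
  then obtain c where c: "y = otype (Restr r (underS r (c y)))" if "y < x" for y by metis
  have "infinite (UNIV :: ('a + nat) set)" by simp
  from infinite_imp_bij_betw[OF this, of undefined] obtain k :: "'a + nat \<Rightarrow> 'a + nat"
    where k: "bij_betw k UNIV (UNIV - {undefined})" by auto
  have "inj (\<lambda>y. if y < x then k (c y) else undefined)"
  proof (rule injI)
    fix y z assume eq: "(if y < x then k (c y) else undefined) = (if z < x then k (c z) else undefined)"
    have "k a \<noteq> undefined" for a using k by (auto simp: bij_betw_def)
    moreover have "inj k" using k by (simp add: bij_betw_def)
    ultimately show "y = z"
      using eq c[of y] c[of z] top[of y] top[of z]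
      by (auto split: if_splits dest: injD) (metis order_le_less)+
  qed
  then show False using ordinal_no_embedding by blast
qed

instantiation ordinal :: (type) zero
begin

definition zero_ordinal :: "'a ordinal" where "zero_ordinal = (LEAST x. True)"

instance ..

end

definition osucc :: "'a ordinal \<Rightarrow> 'a ordinal"
  where "osucc x = (LEAST y. x < y)"

lemma ordinal_zero_le: "(0 :: 'a ordinal) \<le> x"
  unfolding zero_ordinal_def by (rule Least_le) simp

lemma osucc_greater: "x < osucc x"
  unfolding osucc_def using ordinal_ex_greater[of x] by (rule LeastI_ex)

lemma osucc_le_iff: "osucc x \<le> y \<longleftrightarrow> x < y"
  using osucc_greater[of x] by (auto simp: osucc_def intro: Least_le)

lemma osucc_inject: "osucc x = osucc y \<longleftrightarrow> x = y"
  by (metis osucc_greater osucc_le_iff antisym_conv3 leD)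

definition is_limit :: "'a ordinal \<Rightarrow> bool"
  where "is_limit x \<longleftrightarrow> x \<noteq> 0 \<and> (\<nexists>y. x = osucc y)"

section \<open>The subgroups \<open>p\<^sup>\<alpha>G\<close>\<close>

text \<open>
  Abelian groups are written multiplicatively, as usual for \<open>comm_group\<close>; thus \<open>px\<close> is
  \<open>x [^] p\<close>, and \<open>A + B\<close> is \<open>A <#> B\<close>.
\<close>

function ppower :: "nat \<Rightarrow> ('a, 'm) monoid_scheme \<Rightarrow> 'a ordinal \<Rightarrow> 'a set" where
  "ppower p G x =
    (if x = 0 then carrier G
     else if \<exists>y. x = osucc y then (\<lambda>g. g [^]\<^bsub>G\<^esub> p) ` ppower p G (THE y. x = osucc y)
     else (\<Inter>y\<in>{..<x}. ppower p G y))"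
  by auto
termination
proof (relation "inv_image {(x, y). x < y} (\<lambda>(_, _, x). x)", goal_cases)
  case 1
  then show ?case by (intro wf_inv_image wf)
next
  case (2 p G x)
  then show ?case by (auto simp: osucc_inject osucc_greater)
qed auto

declare ppower.simps [simp del]

lemma ppower_zero: "ppower p G 0 = carrier G"
  by (simp add: ppower.simps)

lemma ppower_succ: "ppower p G (osucc x) = (\<lambda>g. g [^]\<^bsub>G\<^esub> p) ` ppower p G x"
proof -
  have "osucc x \<noteq> 0" using osucc_greater[of x] ordinal_zero_le[of x] by auto
  then show ?thesis by (subst ppower.simps) (auto simp: osucc_inject)
qed

lemma ppower_limit: "is_limit x \<Longrightarrow> ppower p G x = (\<Inter>y\<in>{..<x}. ppower p G y)"
  by (subst ppower.simps) (auto simp: is_limit_def)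

definition ulm_length :: "nat \<Rightarrow> ('a, 'm) monoid_scheme \<Rightarrow> 'a ordinal"
  where "ulm_length p G = (LEAST x. ppower p G x = ppower p G (osucc x))"

lemma ex_stationary:
  fixes F :: "'a ordinal \<Rightarrow> 'a set"
  assumes "antimono F"
  shows "\<exists>x. F x = F (osucc x)"
proof (rule ccontr)
  assume "\<not> ?thesis"
  then have "F x - F (osucc x) \<noteq> {}" for x
    using antimonoD[OF assms, of x "osucc x"] osucc_greater[of x] by (auto simp: less_imp_le)
  then have "\<forall>x. \<exists>a. a \<in> F x - F (osucc x)" by blast
  then obtain c where c: "c x \<in> F x - F (osucc x)" for x unfolding choice_iff by blast
  have "c x \<noteq> c y" if "x < y" for x y
    using c[of x] c[of y] antimonoD[OF assms, of "osucc x" y] that by (auto simp: osucc_le_iff)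
  then have "inj c" by (metis injI antisym_conv3)
  then have "inj (Inl \<circ> c :: 'a ordinal \<Rightarrow> 'a + nat)" by (simp add: inj_compose)
  then show False using ordinal_no_embedding by blast
qed

lemma (in comm_group) ppower_subgroup: "subgroup (ppower p G x) G"
proof (induction x rule: less_induct)
  case (less x)
  consider "x = 0" | y where "x = osucc y" | "is_limit x" by (auto simp: is_limit_def)
  then show ?case
  proof cases
    case 1
    then show ?thesis by (simp add: ppower_zero subgroup_self)
  next
    case 2
    then have "subgroup (ppower p G y) G" using less osucc_greater by blast
    moreover have "group_hom G G (\<lambda>g. g [^] p)"
      by unfold_locales (auto simp: hom_def nat_pow_distrib)
    ultimately show ?thesis
      using 2 by (simp add: ppower_succ group_hom.subgroup_img_is_subgroup)
  next
    case 3
    then have "0 \<in> {..<x}" using ordinal_zero_le[of x] by (simp add: is_limit_def order_less_le)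
    then have "{..<x} \<noteq> {}" by blast
    with 3 less show ?thesis
      by (auto simp: ppower_limit intro!: subgroups_Inter)
  qed
qed

lemma (in comm_group) ppower_antimono: "antimono (ppower p G)"
proof (rule antimonoI)
  fix x y :: "'a ordinal"
  show "x \<le> y \<Longrightarrow> ppower p G y \<subseteq> ppower p G x"
  proof (induction y rule: less_induct)
    case (less y)
    show ?case
    proof (cases "x = y")
      case False
      with less.prems have "x < y" by simp
      show ?thesis
      proof (cases "\<exists>z. y = osucc z")
        case True
        then obtain z where z: "y = osucc z" ..
        have "(\<lambda>g. g [^] p) ` ppower p G z \<subseteq> ppower p G z"
        proof clarify
          fix g assume g: "g \<in> ppower p G z"
          have "g [^] n \<in> ppower p G z" for n :: nat
            using g ppower_subgroup[of p z]
            by (induction n) (auto simp: subgroup.m_closed subgroup.one_closed)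
          then show "g [^] p \<in> ppower p G z" .
        qed
        moreover have "x \<le> z" using z \<open>x < y\<close> by (metis osucc_le_iff not_le)
        then have "ppower p G z \<subseteq> ppower p G x"
          using less.IH z osucc_greater by blast
        ultimately show ?thesis by (auto simp: z ppower_succ)
      next
        case False
        moreover have "y \<noteq> 0" using \<open>x < y\<close> ordinal_zero_le[of x] by auto
        ultimately show ?thesis using \<open>x < y\<close> by (auto simp: ppower_limit is_limit_def)
      qed
    qed simp
  qed
qed

lemma (in comm_group) ppower_ulm_length:
  "ppower p G (ulm_length p G) = ppower p G (osucc (ulm_length p G))"
  unfolding ulm_length_def by (rule LeastI_ex[OF ex_stationary[OF ppower_antimono]])

section \<open>Large subgroups and \<open>\<sigma>\<close>-summability\<close>

definition abelian_p_group :: "nat \<Rightarrow> ('a, 'm) monoid_scheme \<Rightarrow> bool"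
  where "abelian_p_group p G \<longleftrightarrow>
    comm_group G \<and> (\<forall>x\<in>carrier G. \<exists>n::nat. x [^]\<^bsub>G\<^esub> (p ^ n) = \<one>\<^bsub>G\<^esub>)"

text \<open>
  Every direct sum of cyclic groups that is isomorphic to \<open>G\<close> can be brought into the form below:
  drop the trivial summands, embed the others into \<open>G\<close>, and index each by a generator of its image.
\<close>

definition direct_sum_of_cyclics :: "('a, 'm) monoid_scheme \<Rightarrow> bool"
  where "direct_sum_of_cyclics G \<longleftrightarrow>
    (\<exists>(I :: 'a set) (H :: 'a \<Rightarrow> 'a monoid).
      (\<forall>i\<in>I. group (H i) \<and> cyclic_group (H i)) \<and> G \<cong> sum_group I H)"

definition pure_subgroup :: "'a set \<Rightarrow> ('a, 'm) monoid_scheme \<Rightarrow> bool"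
  where "pure_subgroup B G \<longleftrightarrow> subgroup B G \<and>
    (\<forall>n::nat. B \<inter> (\<lambda>x. x [^]\<^bsub>G\<^esub> n) ` carrier G = (\<lambda>x. x [^]\<^bsub>G\<^esub> n) ` B)"

definition divisible_group :: "('a, 'm) monoid_scheme \<Rightarrow> bool"
  where "divisible_group G \<longleftrightarrow> (\<forall>n::nat. n > 0 \<longrightarrow> (\<lambda>x. x [^]\<^bsub>G\<^esub> n) ` carrier G = carrier G)"

text \<open>Basic subgroups of abelian \<open>p\<close>-groups, in the sense of Kulikov.\<close>

definition basic_subgroup :: "'a set \<Rightarrow> ('a, 'm) monoid_scheme \<Rightarrow> bool"
  where "basic_subgroup B G \<longleftrightarrow>
    pure_subgroup B G \<and> direct_sum_of_cyclics (G\<lparr>carrier := B\<rparr>) \<and> divisible_group (G Mod B)"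

definition fully_invariant :: "'a set \<Rightarrow> ('a, 'm) monoid_scheme \<Rightarrow> bool"
  where "fully_invariant L G \<longleftrightarrow> subgroup L G \<and> (\<forall>f\<in>hom G G. f ` L \<subseteq> L)"

definition large_subgroup :: "'a set \<Rightarrow> ('a, 'm) monoid_scheme \<Rightarrow> bool"
  where "large_subgroup L G \<longleftrightarrow>
    fully_invariant L G \<and> (\<forall>B. basic_subgroup B G \<longrightarrow> carrier G = L <#>\<^bsub>G\<^esub> B)"

definition socle :: "nat \<Rightarrow> ('a, 'm) monoid_scheme \<Rightarrow> 'a set"
  where "socle p G = {g \<in> carrier G. g [^]\<^bsub>G\<^esub> p = \<one>\<^bsub>G\<^esub>}"

definition sigma_summable :: "nat \<Rightarrow> ('a, 'm) monoid_scheme \<Rightarrow> bool"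
  where "sigma_summable p C \<longleftrightarrow>
    (\<exists>S :: nat \<Rightarrow> 'a set.
      (\<forall>n. subgroup (S n) C \<and> S n \<subseteq> socle p C \<and> S n \<subseteq> S (Suc n)) \<and>
      socle p C = (\<Union>n. S n) \<and>
      (\<forall>n. \<exists>\<alpha> < ulm_length p C. S n \<inter> ppower p C \<alpha> = {\<one>\<^bsub>C\<^esub>}))"

end

theory Submission
  imports Defs
begin

text \<open>
  The key is Pierce's condition: if \<open>L\<close> is large, then for every \<open>k\<close> some \<open>p\<^sup>mG\<close> has all its elements
  of order at most \<open>p\<^sup>k\<close> in \<open>L\<close>. To see this, take a basic subgroup \<open>B = \<Oplus> \<langle>x\<rangle>\<close>, where \<open>x\<close> ranges over a maximal
  pure-independent set. If \<open>p\<^sup>M B = 0\<close>, then \<open>p\<^sup>MG = p\<^sup>ML \<subseteq> L\<close>. If \<open>p\<^sup>n\<^sup>-\<^sup>kx \<in> L\<close> for some \<open>x\<close> of order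
  \<open>p\<^sup>n\<close>, \<open>n \<ge> k\<close>, then endomorphisms of \<open>G\<close> move this element onto every element of \<open>p\<^sup>nG[p\<^sup>k]\<close>.
  Otherwise every coordinate of an element of \<open>L \<inter> B\<close> has order less than \<open>p\<^sup>k\<close>, since \<open>L\<close> is invariant
  under the coordinate projections, and a basic subgroup \<open>B'\<close> with \<open>B/B' \<cong> \<int>(p\<^sup>\<infinity>)\<close> violates
  \<open>G = L + B'\<close>.

  Pierce's condition gives \<open>p\<^sup>\<alpha>L = p\<^sup>\<alpha>G\<close> for \<open>\<alpha> \<ge> \<omega>\<close> and, for each \<open>n\<close>, some \<open>m\<close> with
  \<open>p\<^sup>mG[p] \<subseteq> p\<^sup>nL\<close>. A \<open>\<sigma>\<close>-summable group has infinite length, so \<open>G\<close> and \<open>L\<close> have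
  the same length once one of them is \<open>\<sigma>\<close>-summable. A filtration of \<open>G[p]\<close> restricts to \<open>L[p]\<close>; conversely
  a filtration \<open>T\<^sub>n\<close> of \<open>L[p]\<close> yields \<open>(T\<^sub>n \<inter> W) + K\<close>, where \<open>W = p\<^sup>mG[p] \<subseteq> L\<close> and \<open>K\<close> is a
  complement of \<open>W\<close> in \<open>G[p]\<close>.
\<close>

section \<open>Pure-independent families in abelian \<open>p\<close>-groups\<close>

context comm_group
begin

text \<open>Coefficients form the free abelian group on the index type, so a relation between
  members of the family is an element of that group and a change of family is a homomorphism of
  coefficients.\<close>

definition lincomb :: "('i \<Rightarrow> 'a) \<Rightarrow> ('i \<Rightarrow>\<^sub>0 int) \<Rightarrow> 'a"
  where "lincomb h c = (\<Otimes>i\<in>Poly_Mapping.keys c. h i [^] Poly_Mapping.lookup c i)"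

definition lspan :: "('i \<Rightarrow> 'a) \<Rightarrow> 'i set \<Rightarrow> 'a set"
  where "lspan h I = lincomb h ` {c. Poly_Mapping.keys c \<subseteq> I}"

context
  fixes h :: "'i \<Rightarrow> 'a"
  assumes h: "\<And>i. h i \<in> carrier G"
begin

lemma lincomb_closed [simp, intro]: "lincomb h c \<in> carrier G"
  by (auto simp: lincomb_def h)

lemma lincomb_superset:
  assumes "finite A" "Poly_Mapping.keys c \<subseteq> A"
  shows "lincomb h c = (\<Otimes>i\<in>A. h i [^] Poly_Mapping.lookup c i)"
  unfolding lincomb_def using assms h
  by (intro finprod_mono_neutral_cong_left) (auto simp: in_keys_iff)

lemma lincomb_add: "lincomb h (c + d) = lincomb h c \<otimes> lincomb h d"
proof -
  let ?A = "Poly_Mapping.keys c \<union> Poly_Mapping.keys d"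
  have "lincomb h (c + d) = (\<Otimes>i\<in>?A. h i [^] Poly_Mapping.lookup (c + d) i)"
    by (rule lincomb_superset) (auto simp: keys_add)
  also have "\<dots> = (\<Otimes>i\<in>?A. h i [^] Poly_Mapping.lookup c i \<otimes> h i [^] Poly_Mapping.lookup d i)"
    by (simp add: lookup_add int_pow_mult h)
  also have "\<dots> = (\<Otimes>i\<in>?A. h i [^] Poly_Mapping.lookup c i) \<otimes> (\<Otimes>i\<in>?A. h i [^] Poly_Mapping.lookup d i)"
    using h by (intro finprod_multf) auto
  also have "\<dots> = lincomb h c \<otimes> lincomb h d"
    by (simp add: lincomb_superset[of ?A])
  finally show ?thesis .
qed

lemma lincomb_hom: "lincomb h \<in> hom (free_Abelian_group UNIV) G"
  by (rule homI) (auto simp: lincomb_add)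

lemma lincomb_zero [simp]: "lincomb h 0 = \<one>"
  by (simp add: lincomb_def)

lemma lincomb_of [simp]: "lincomb h (frag_of i) = h i"
  by (simp add: lincomb_def h)

lemma lincomb_cmul: "lincomb h (frag_cmul n c) = lincomb h c [^] n"
  using hom_int_pow[OF lincomb_hom, of c n] by simp

lemma lincomb_diff: "lincomb h (c - d) = lincomb h c \<otimes> inv lincomb h d"
  using lincomb_add[of c "- d"] lincomb_cmul[of "-1" d] by (simp add: int_pow_neg)


lemma lspan_subgroup: "subgroup (lspan h I) G"
proof (rule subgroupI)
  show "lspan h I \<subseteq> carrier G" by (auto simp: lspan_def)
  show "lspan h I \<noteq> {}" by (auto simp: lspan_def intro: exI[of _ 0])
  fix a assume "a \<in> lspan h I"
  then obtain c where c: "Poly_Mapping.keys c \<subseteq> I" "a = lincomb h c" by (auto simp: lspan_def)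
  then have "inv a = lincomb h (- c)" using lincomb_diff[of 0 c] by simp
  with c show "inv a \<in> lspan h I" by (auto simp: lspan_def)
  fix b assume "b \<in> lspan h I"
  then obtain d where d: "Poly_Mapping.keys d \<subseteq> I" "b = lincomb h d" by (auto simp: lspan_def)
  have "a \<otimes> b = lincomb h (c + d)" "Poly_Mapping.keys (c + d) \<subseteq> I"
    using c d keys_add[of c d] by (auto simp: lincomb_add)
  then show "a \<otimes> b \<in> lspan h I" by (auto simp: lspan_def)
qed

lemma lspan_least: "lspan h I \<subseteq> H" if "subgroup H G" "\<And>i. i \<in> I \<Longrightarrow> h i \<in> H"
proof -
  have "lincomb h c \<in> H" if "Poly_Mapping.keys c \<subseteq> I" for c
    using that
  proof (induction c rule: frag_induction)
    case (diff a b)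
    then show ?case using \<open>subgroup H G\<close>
      by (simp add: lincomb_diff subgroup.m_closed subgroup.m_inv_closed)
  qed (use that \<open>\<And>i. i \<in> I \<Longrightarrow> h i \<in> H\<close> \<open>subgroup H G\<close> in \<open>auto simp: subgroup.one_closed\<close>)
  then show ?thesis by (auto simp: lspan_def)
qed

end

text \<open>Both sides are homomorphisms in \<open>c\<close> that agree on generators. This lets
  combinations of a derived family such as \<open>twist s\<close> be read in the coordinates of the
  original one.\<close>

lemma lincomb_frag_extend:
  assumes h: "\<And>i. h i \<in> carrier G"
  shows "lincomb h (frag_extend f c) = lincomb (\<lambda>i. lincomb h (f i)) c"
proof -
  have "Poly_Mapping.keys c \<subseteq> UNIV" by simp
  then show ?thesis
    by (induction c rule: frag_induction)
      (simp_all add: frag_extend_diff lincomb_diff lincomb_closed h)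
qed

end

lemma (in group) subset_set_mult:
  assumes "subgroup H G" "subgroup K G"
  shows "H \<subseteq> H <#> K" "K \<subseteq> H <#> K"
  using subgroup.one_closed[OF assms(1)] subgroup.one_closed[OF assms(2)]
    subgroup.mem_carrier[OF assms(1)] subgroup.mem_carrier[OF assms(2)]
  by (force simp: set_mult_def)+

section \<open>Orders of elements, multiples by powers of p, and pure independence\<close>

locale p_torsion_group = comm_group G for G (structure) +
  fixes p :: nat
  assumes prime_p: "Factorial_Ring.prime p"
    and p_torsion: "x \<in> carrier G \<Longrightarrow> \<exists>n. x [^] (p ^ n) = \<one>"
begin

text \<open>The logarithm of the order to base p, since all orders are powers of p
  (\<open>ord_eq\<close>).\<close>

definition expo :: "'a \<Rightarrow> nat"
  where "expo x = multiplicity p (ord x)"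

lemma ord_eq: "ord x = p ^ expo x" if "x \<in> carrier G"
proof -
  obtain n where "x [^] (p ^ n) = \<one>" using p_torsion \<open>x \<in> carrier G\<close> by blast
  then have "ord x dvd p ^ n" using that pow_eq_id by blast
  then obtain m where "ord x = p ^ m" using divides_primepow_nat[OF prime_p] by blast
  then show ?thesis using prime_p by (simp add: expo_def)
qed

lemma pow_eq_one_iff: "x [^] k = \<one> \<longleftrightarrow> int p ^ expo x dvd k" if "x \<in> carrier G" for k :: int
  using int_pow_eq_id[OF that, of k] ord_eq[OF that] by simp

definition mults :: "nat \<Rightarrow> 'a set"
  where "mults n = (\<lambda>g. g [^] (int p ^ n)) ` carrier G"

lemma mults_subgroup: "subgroup (mults n) G"
proof -
  have "(\<lambda>g. g [^] (int p ^ n)) \<in> hom G G"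
    by (auto intro!: homI simp: int_pow_distrib)
  then interpret group_hom G G "\<lambda>g. g [^] (int p ^ n)"
    by unfold_locales
  show ?thesis unfolding mults_def by (rule img_is_subgroup)
qed

lemma mults_antimono: "mults n \<subseteq> mults m" if "m \<le> n"
proof
  fix x assume "x \<in> mults n"
  then obtain g where g: "g \<in> carrier G" "x = g [^] (int p ^ n)" by (auto simp: mults_def)
  have "int p ^ n = int p ^ (n - m) * int p ^ m" using that by (simp flip: power_add)
  with g have "x = (g [^] (int p ^ (n - m))) [^] (int p ^ m)" by (simp add: int_pow_pow)
  with g show "x \<in> mults m" unfolding mults_def by blast
qed

text \<open>With \<open>n\<close> large this says that the family is independent; in general it also says
  that its span is a pure subgroup.\<close>
definition pure_independent :: "('i \<Rightarrow> 'a) \<Rightarrow> 'i set \<Rightarrow> bool"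
  where "pure_independent h I \<longleftrightarrow>
    (\<forall>c n. Poly_Mapping.keys c \<subseteq> I \<longrightarrow> lincomb h c \<in> mults n \<longrightarrow>
      (\<forall>i\<in>I. int p ^ min n (expo (h i)) dvd Poly_Mapping.lookup c i))"

lemma pure_independentD:
  "pure_independent h I \<Longrightarrow> Poly_Mapping.keys c \<subseteq> I \<Longrightarrow> lincomb h c \<in> mults n \<Longrightarrow> i \<in> I \<Longrightarrow>
    int p ^ min n (expo (h i)) dvd Poly_Mapping.lookup c i"
  by (auto simp: pure_independent_def)

lemma pure_independent_one:
  assumes "pure_independent h I" "Poly_Mapping.keys c \<subseteq> I" "lincomb h c = \<one>" "i \<in> I"
  shows "int p ^ expo (h i) dvd Poly_Mapping.lookup c i"
  using pure_independentD[OF assms(1,2) _ assms(4), of "expo (h i)"] assms(3)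
    subgroup.one_closed[OF mults_subgroup] by simp

lemma lincomb_eq_one:
  assumes "\<And>i. h i \<in> carrier G"
    and "\<And>i. i \<in> Poly_Mapping.keys c \<Longrightarrow> int p ^ expo (h i) dvd Poly_Mapping.lookup c i"
  shows "lincomb h c = \<one>"
  unfolding lincomb_def using assms by (intro finprod_one_eqI) (simp add: pow_eq_one_iff)

lemma pure_independent_eqD:
  assumes h: "\<And>i. h i \<in> carrier G" and "pure_independent h I"
    and "Poly_Mapping.keys c \<subseteq> I" "Poly_Mapping.keys d \<subseteq> I" "lincomb h c = lincomb h d" "i \<in> I"
  shows "int p ^ expo (h i) dvd Poly_Mapping.lookup c i - Poly_Mapping.lookup d i"
proof -
  have "Poly_Mapping.keys (c - d) \<subseteq> I" using assms keys_diff[of c d] by blast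
  moreover have "lincomb h (c - d) = \<one>" using assms by (simp add: lincomb_diff lincomb_closed)
  ultimately show ?thesis
    using pure_independent_one[of h I "c - d" i] assms by (simp add: lookup_minus)
qed

section \<open>The span of a pure-independent family: purity, divisible quotient, decomposition into
  cyclic groups\<close>

lemma lspan_pure_p:
  assumes h: "\<And>i. h i \<in> carrier G" and pi: "pure_independent h I"
    and b: "b \<in> lspan h I" "b \<in> mults n"
  obtains b' where "b' \<in> lspan h I" "b = b' [^] (int p ^ n)"
proof -
  obtain c where c: "Poly_Mapping.keys c \<subseteq> I" "b = lincomb h c" using b by (auto simp: lspan_def)
  define a where "a i = (if n \<le> expo (h i) then Poly_Mapping.lookup c i div int p ^ n else 0)" for i
  have fin: "finite {i. a i \<noteq> 0}"
    by (rule finite_subset[of _ "Poly_Mapping.keys c"]) (auto simp: a_def in_keys_iff)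
  define d where "d = Abs_poly_mapping a"
  have ld: "Poly_Mapping.lookup d = a" using fin by (simp add: d_def)
  have kd: "Poly_Mapping.keys d \<subseteq> I"
    using c by (auto simp: in_keys_iff ld a_def subset_iff split: if_splits)
      (metis div_0)
  have "int p ^ expo (h i) dvd Poly_Mapping.lookup (c - frag_cmul (int p ^ n) d) i"
    if "i \<in> I" for i
    using pure_independentD[OF pi c(1) _ that, of n] b c
    by (auto simp: lookup_minus ld a_def min_def split: if_splits)
  moreover have "Poly_Mapping.keys (c - frag_cmul (int p ^ n) d) \<subseteq> I"
    using keys_diff[of c "frag_cmul (int p ^ n) d"] c kd keys_cmul by blast
  ultimately have "lincomb h (c - frag_cmul (int p ^ n) d) = \<one>"
    using h by (intro lincomb_eq_one) auto
  then have "lincomb h c = lincomb h d [^] (int p ^ n)"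
    using h by (simp add: lincomb_diff lincomb_cmul lincomb_closed) (metis inv_closed inv_equality inv_inv int_pow_closed lincomb_closed)
  then show thesis using that[of "lincomb h d"] kd c by (auto simp: lspan_def)
qed

text \<open>By Bezout, q is invertible modulo the order of b, which is a power of p; hence b is q
  times a multiple of itself.\<close>

lemma coprime_root:
  assumes B: "subgroup B G" "b \<in> B" and q: "coprime p q"
  shows "\<exists>b'\<in>B. b = b' [^] (q :: nat)"
proof -
  have b: "b \<in> carrier G" using B subgroup.mem_carrier by fast
  obtain u v where uv: "u * (int p ^ expo b) + v * int q = 1"
    using bezout_int[of "int p ^ expo b" "int q"] q by auto
  have "b = b [^] (u * (int p ^ expo b) + v * int q)" using b uv by simp
  also have "\<dots> = b [^] (u * (int p ^ expo b)) \<otimes> b [^] (v * int q)" using b by (simp add: int_pow_mult)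
  also have "b [^] (u * (int p ^ expo b)) = \<one>" using b by (simp add: pow_eq_one_iff)
  also have "b [^] (v * int q) = (b [^] v) [^] q"
    using b int_pow_pow[OF b, of v "int q"] by (simp add: int_pow_int)
  finally have "b = (b [^] v) [^] q" using b by simp
  moreover have "b [^] v \<in> B" using B subgroup_int_pow_closed by blast
  ultimately show ?thesis by blast
qed

lemma nat_decompose:
  assumes "n > 0"
  obtains a q where "n = p ^ a * q" "coprime p q"
proof -
  obtain q where q: "n = p ^ multiplicity p n * q" "\<not> p dvd q"
    using multiplicity_decompose'[of n p] assms prime_p by (metis not_prime_unit gr0_implies_Suc nat.distinct(1))
  then show thesis using that prime_imp_coprime[OF prime_p] by blast
qed

lemma pow_nat_p: "x [^] (p ^ n) = x [^] (int p ^ n)"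
  using int_pow_int[of G x "p ^ n"] by simp

text \<open>For n = p^a q with q prime to p, the factor p^a is handled by
  \<open>lspan_pure_p\<close>, and division by q is possible inside every subgroup.\<close>

lemma lspan_pure:
  assumes h: "\<And>i. h i \<in> carrier G" and pi: "pure_independent h I"
  shows "pure_subgroup (lspan h I) G"
  unfolding pure_subgroup_def
proof (intro conjI allI)
  let ?B = "lspan h I"
  show B: "subgroup ?B G" by (rule lspan_subgroup[OF h])
  fix n :: nat
  show "?B \<inter> (\<lambda>x. x [^] n) ` carrier G = (\<lambda>x. x [^] n) ` ?B"
  proof (cases "n = 0")
    case True
    then show ?thesis using subgroup.one_closed[OF B] by auto
  next
    case False
    then obtain a q where n: "n = p ^ a * q" "coprime p q" using nat_decompose by blast
    have "b \<in> (\<lambda>x. x [^] n) ` ?B" if b: "b \<in> ?B" and g: "g \<in> carrier G" "b = g [^] n" for b g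
    proof -
      have "b = (g [^] q) [^] (int p ^ a)"
        using g n by (simp add: nat_pow_pow mult.commute flip: pow_nat_p)
      then have "b \<in> mults a" using g by (auto simp: mults_def)
      then obtain b1 where b1: "b1 \<in> ?B" "b = b1 [^] (int p ^ a)"
        using lspan_pure_p[OF h pi b] by blast
      obtain b2 where b2: "b2 \<in> ?B" "b1 = b2 [^] q" using coprime_root[OF B b1(1) n(2)] by blast
      then have "b2 \<in> carrier G" using B subgroup.mem_carrier by fast
      then have "b = b2 [^] n"
        using b1 b2 n by (simp add: nat_pow_pow mult.commute flip: pow_nat_p)
      with b2 show ?thesis by blast
    qed
    moreover have "x [^] n \<in> ?B" "x \<in> carrier G" if "x \<in> ?B" for x
      using that B subgroup.mem_carrier[OF B] subgroup_int_pow_closed[OF B that, of "int n"]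
      by (auto simp: int_pow_int)
    ultimately show ?thesis by auto
  qed
qed

text \<open>Substituting G = B + pG into itself n times gives G = B + p^n G.\<close>

lemma add_mults_cover:
  assumes B: "subgroup B G" and cov: "\<And>x. x \<in> carrier G \<Longrightarrow> x \<in> B <#> mults 1"
    and x: "x \<in> carrier G"
  shows "\<exists>b\<in>B. \<exists>g\<in>carrier G. x = b \<otimes> g [^] (int p ^ n)"
proof (induction n)
  case 0
  then show ?case using x subgroup.one_closed[OF B] by force
next
  case (Suc n)
  then obtain b g where bg: "b \<in> B" "g \<in> carrier G" "x = b \<otimes> g [^] (int p ^ n)" by blast
  obtain b' g' where bg': "b' \<in> B" "g' \<in> carrier G" "g = b' \<otimes> g' [^] int p"
    using cov[OF bg(2)] by (auto simp: set_mult_def mults_def)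
  have car: "b \<in> carrier G" "b' \<in> carrier G" using B bg bg' subgroup.mem_carrier by fast+
  have "x = (b \<otimes> b' [^] (int p ^ n)) \<otimes> g' [^] (int p ^ Suc n)"
    using bg bg' car by (simp add: int_pow_distrib int_pow_pow m_assoc)
  moreover have "b \<otimes> b' [^] (int p ^ n) \<in> B"
    using B bg bg' subgroup_int_pow_closed subgroup.m_closed by metis
  ultimately show ?case using bg' by blast
qed

text \<open>With n = p^a q as before, G = B + p^a G makes every coset p^a times a coset, and
  \<open>coprime_root\<close> in G supplies the division by q.\<close>

lemma divisible_Mod:
  assumes B: "subgroup B G" and cov: "\<And>x. x \<in> carrier G \<Longrightarrow> x \<in> B <#> mults 1"
  shows "divisible_group (G Mod B)"
  unfolding divisible_group_def
proof (intro allI impI)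
  fix n :: nat assume "n > 0"
  interpret B: normal B G using B by (rule subgroup_imp_normal)
  obtain a q where n: "n = p ^ a * q" "coprime p q" using nat_decompose \<open>n > 0\<close> by blast
  have grp: "group (G Mod B)" by (rule B.factorgroup_is_group)
  have "B #> x \<in> (\<lambda>U. U [^]\<^bsub>G Mod B\<^esub> n) ` carrier (G Mod B)" if x: "x \<in> carrier G" for x
  proof -
    obtain b g where bg: "b \<in> B" "g \<in> carrier G" "x = b \<otimes> g [^] (int p ^ a)"
      using add_mults_cover[OF B cov x] by blast
    obtain g' where g': "g' \<in> carrier G" "g = g' [^] q"
      using coprime_root[OF subgroup_self bg(2) n(2)] by blast
    have "x = b \<otimes> g' [^] n"
      using bg g' n by (simp add: nat_pow_pow mult.commute flip: pow_nat_p)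
    then have "B #> x = B #> (g' [^] n)"
      using bg g' B by (metis B.mem_carrier coset_mult_assoc coset_join2 nat_pow_closed B.subset)
    also have "\<dots> = (B #> g') [^]\<^bsub>G Mod B\<^esub> n"
      using hom_nat_pow[OF B.r_coset_hom_Mod g'(1) group_axioms grp] by simp
    finally show ?thesis using g' by (auto simp: FactGroup_def RCOSETS_def)
  qed
  moreover have "carrier (G Mod B) = (\<lambda>x. B #> x) ` carrier G"
    by (auto simp: FactGroup_def RCOSETS_def)
  ultimately have "carrier (G Mod B) \<subseteq> (\<lambda>U. U [^]\<^bsub>G Mod B\<^esub> n) ` carrier (G Mod B)"
    by (simp only: image_subset_iff) blast
  moreover have "(\<lambda>U. U [^]\<^bsub>G Mod B\<^esub> n) ` carrier (G Mod B) \<subseteq> carrier (G Mod B)"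
    by (intro image_subsetI monoid.nat_pow_closed group.is_monoid[OF grp])
  ultimately show "(\<lambda>U. U [^]\<^bsub>G Mod B\<^esub> n) ` carrier (G Mod B) = carrier (G Mod B)"
    by (rule equalityI[rotated])
qed

lemma lspan_direct_sum_of_cyclics:
  fixes h :: "'a \<Rightarrow> 'a"
  assumes h: "\<And>i. h i \<in> carrier G" and pi: "pure_independent h I"
  shows "direct_sum_of_cyclics (G\<lparr>carrier := lspan h I\<rparr>)"
proof -
  \<comment> \<open>\<open>direct_sum_of_cyclics\<close> asks for summands of type
    \<open>'a monoid\<close>, so the extension fields of \<open>G\<close> are dropped.\<close>
  define G0 :: "'a monoid" where "G0 = \<lparr>carrier = carrier G, monoid.mult = (\<otimes>), one = \<one>\<rparr>"
  have G0 [simp]: "carrier G0 = carrier G" "monoid.mult G0 = (\<otimes>)" "one G0 = \<one>"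
    by (simp_all add: G0_def)
  have "\<exists>y\<in>carrier G. y \<otimes> x = \<one>" if "x \<in> carrier G" for x
    using that l_inv by blast
  then interpret G0: comm_group G0
    by (intro comm_groupI) (simp_all add: m_ac)
  have inv0: "m_inv G0 = m_inv G" by (simp add: m_inv_def fun_eq_iff)
  have pow0: "x [^]\<^bsub>G0\<^esub> (k :: int) = x [^] k" for x k
    by (simp add: int_pow_def nat_pow_def inv0 Let_def)
  define H where "H i = subgroup_generated G0 {h i}" for i
  have carH: "carrier (H i) = range (\<lambda>k :: int. h i [^] k)" for i
    using G0.carrier_subgroup_generated_by_singleton[of "h i"] h by (simp add: H_def pow0)
  have H: "group (H i)" "cyclic_group (H i)" "monoid.mult (H i) = (\<otimes>)" "one (H i) = \<one>" for i
    using h by (auto simp: H_def G0.cyclic_group_generated)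
  \<comment> \<open>The coefficients of b are determined only modulo the orders of the generators.
    The choice is harmless because \<open>\<psi>\<close> records the multiples of the generators,
    not the coefficients.\<close>
  define coeff where "coeff b = (SOME c. Poly_Mapping.keys c \<subseteq> I \<and> lincomb h c = b)" for b
  define \<psi> where "\<psi> b = (\<lambda>i\<in>I. h i [^] Poly_Mapping.lookup (coeff b) i)" for b
  have \<psi>: "\<psi> (lincomb h d) = (\<lambda>i\<in>I. h i [^] Poly_Mapping.lookup d i)"
    if d: "Poly_Mapping.keys d \<subseteq> I" for d
  proof -
    have c: "Poly_Mapping.keys (coeff (lincomb h d)) \<subseteq> I \<and> lincomb h (coeff (lincomb h d)) = lincomb h d"
      unfolding coeff_def by (rule someI_ex) (use d in blast)
    show ?thesis
      unfolding \<psi>_def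
      using pure_independent_eqD[OF h pi, of d "coeff (lincomb h d)"] c d h
      by (intro restrict_ext) (simp add: int_pow_eq ord_eq)
  qed
  have sum: "carrier (sum_group I H) = {x \<in> \<Pi>\<^sub>E i\<in>I. carrier (H i). finite {i \<in> I. x i \<noteq> \<one>}}"
    using H by (subst carrier_sum_group) auto
  have "\<psi> \<in> iso (G\<lparr>carrier := lspan h I\<rparr>) (sum_group I H)"
  proof (rule isoI)
    show "\<psi> \<in> hom (G\<lparr>carrier := lspan h I\<rparr>) (sum_group I H)"
    proof (rule homI)
      fix x assume "x \<in> carrier (G\<lparr>carrier := lspan h I\<rparr>)"
      then obtain d where d: "Poly_Mapping.keys d \<subseteq> I" "x = lincomb h d" by (auto simp: lspan_def)
      have "{i \<in> I. h i [^] Poly_Mapping.lookup d i \<noteq> \<one>} \<subseteq> Poly_Mapping.keys d"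
        by (auto simp: in_keys_iff)
      with d show "\<psi> x \<in> carrier (sum_group I H)"
        by (auto simp: sum \<psi> carH cong: conj_cong intro: finite_subset)
    next
      fix x y assume "x \<in> carrier (G\<lparr>carrier := lspan h I\<rparr>)" "y \<in> carrier (G\<lparr>carrier := lspan h I\<rparr>)"
      then obtain d e where d: "Poly_Mapping.keys d \<subseteq> I" "x = lincomb h d"
        and e: "Poly_Mapping.keys e \<subseteq> I" "y = lincomb h e" by (auto simp: lspan_def)
      have "x \<otimes> y = lincomb h (d + e)" using d e h by (simp add: lincomb_add)
      moreover have "Poly_Mapping.keys (d + e) \<subseteq> I" using d e keys_add[of d e] by blast
      ultimately show "\<psi> (x \<otimes>\<^bsub>G\<lparr>carrier := lspan h I\<rparr>\<^esub> y) = \<psi> x \<otimes>\<^bsub>sum_group I H\<^esub> \<psi> y"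
        using d e h by (auto simp: \<psi> H lookup_add int_pow_mult intro!: restrict_ext)
    qed
    show "bij_betw \<psi> (carrier (G\<lparr>carrier := lspan h I\<rparr>)) (carrier (sum_group I H))"
      unfolding bij_betw_def
    proof
      show "inj_on \<psi> (carrier (G\<lparr>carrier := lspan h I\<rparr>))"
      proof (rule inj_onI)
        fix x y assume "x \<in> carrier (G\<lparr>carrier := lspan h I\<rparr>)" "y \<in> carrier (G\<lparr>carrier := lspan h I\<rparr>)"
          and eq: "\<psi> x = \<psi> y"
        then obtain d e where d: "Poly_Mapping.keys d \<subseteq> I" "x = lincomb h d"
          and e: "Poly_Mapping.keys e \<subseteq> I" "y = lincomb h e" by (auto simp: lspan_def)
        have "h i [^] Poly_Mapping.lookup d i = h i [^] Poly_Mapping.lookup e i" if "i \<in> I" for i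
          using fun_cong[OF eq, of i] that d e by (simp add: \<psi>)
        then have "int p ^ expo (h i) dvd Poly_Mapping.lookup (e - d) i" if "i \<in> I" for i
          using that h by (simp add: lookup_minus int_pow_eq ord_eq)
        moreover have "Poly_Mapping.keys (e - d) \<subseteq> I" using d e keys_diff[of e d] by blast
        ultimately have "lincomb h (e - d) = \<one>"
          using h by (intro lincomb_eq_one) blast+
        then show "x = y"
          using d e h by (simp add: lincomb_diff lincomb_closed) (metis inv_closed inv_equality inv_inv lincomb_closed)
      qed
      show "\<psi> ` carrier (G\<lparr>carrier := lspan h I\<rparr>) = carrier (sum_group I H)" (is "?L = ?R")
      proof
        show "?L \<subseteq> ?R"
          using \<open>\<psi> \<in> hom _ _\<close> by (auto simp: hom_def)
        show "?R \<subseteq> ?L"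
        proof
          fix f assume f: "f \<in> ?R"
          then have "\<forall>i\<in>I. \<exists>k :: int. f i = h i [^] k" by (fastforce simp: sum carH)
          then obtain k :: "'a \<Rightarrow> int" where k: "f i = h i [^] k i" if "i \<in> I" for i by metis
          \<comment> \<open>The chosen \<open>k\<close> may be nonzero at infinitely many indices;
            resetting it to 0 wherever \<open>f\<close> is trivial gives finite support.\<close>
          define k' where "k' i = (if i \<in> I \<and> f i \<noteq> \<one> then k i else 0)" for i
          have "finite {i. k' i \<noteq> 0}"
            using f by (auto simp: sum k'_def elim!: rev_finite_subset)
          then have l: "Poly_Mapping.lookup (Abs_poly_mapping k') = k'" by simp
          have ks: "Poly_Mapping.keys (Abs_poly_mapping k') \<subseteq> I"
            by (auto simp: in_keys_iff l k'_def split: if_splits)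
          have "f = \<psi> (lincomb h (Abs_poly_mapping k'))"
            using f k by (auto simp: \<psi>[OF ks] l k'_def sum PiE_iff extensional_def fun_eq_iff)
          with ks show "f \<in> ?L" by (auto simp: lspan_def)
        qed
      qed
    qed
  qed
  then show ?thesis
    unfolding direct_sum_of_cyclics_def is_iso_def
    by (intro exI[of _ I] exI[of _ H]) (use H in auto)
qed

lemma basic_subgroup_lspan:
  fixes h :: "'a \<Rightarrow> 'a"
  assumes "\<And>i. h i \<in> carrier G" "pure_independent h I"
    and "\<And>x. x \<in> carrier G \<Longrightarrow> x \<in> lspan h I <#> mults 1"
  shows "basic_subgroup (lspan h I) G"
  unfolding basic_subgroup_def
proof (intro conjI)
  show "pure_subgroup (lspan h I) G" by (rule lspan_pure[OF assms(1,2)])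
  show "direct_sum_of_cyclics (G\<lparr>carrier := lspan h I\<rparr>)"
    by (rule lspan_direct_sum_of_cyclics[OF assms(1,2)])
  show "divisible_group (G Mod lspan h I)"
    by (rule divisible_Mod[OF lspan_subgroup[OF assms(1)] assms(3)])
qed

text \<open>The identity family, made total on the type so that no carrier conditions on indices arise.\<close>
definition gen :: "'a \<Rightarrow> 'a"
  where "gen x = (if x \<in> carrier G then x else \<one>)"

lemma gen_closed [simp]: "gen x \<in> carrier G"
  by (simp add: gen_def)

section \<open>Maximal pure-independent sets and their basic subgroups\<close>

lemma prime_int: "Factorial_Ring.prime (int p)"
  using prime_p by simp

lemma int_p_power_dvd_iff: "int p ^ a dvd int p ^ b \<longleftrightarrow> a \<le> b"
  using prime_gt_1_nat[OF prime_p]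
  by (metis le_imp_power_dvd of_nat_dvd_iff of_nat_power power_dvd_imp_le)

text \<open>By Bezout for u and p^(a-b), the number p^b is an integer combination of u p^b and
  p^a.\<close>

lemma pow_p_coprime:
  assumes M: "subgroup M G" and x: "x \<in> carrier G" "x [^] (int p ^ a) \<in> M" "x [^] (u * int p ^ b) \<in> M"
    and u: "\<not> int p dvd u" and "b \<le> a"
  shows "x [^] (int p ^ b) \<in> M"
proof -
  have "coprime u (int p ^ (a - b))"
    using prime_imp_coprime[OF prime_int u] by (simp add: coprime_commute)
  then obtain v w where vw: "v * u + w * int p ^ (a - b) = 1"
    using bezout_int[of u "int p ^ (a - b)"] by auto
  have ab: "int p ^ (a - b) * int p ^ b = int p ^ a" using \<open>b \<le> a\<close> by (simp flip: power_add)
  have "(u * int p ^ b) * v + int p ^ a * w = int p ^ b * (v * u + w * int p ^ (a - b))"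
    unfolding ab[symmetric] by (simp add: algebra_simps)
  then have "x [^] (int p ^ b) = x [^] ((u * int p ^ b) * v + int p ^ a * w)" by (simp add: vw)
  also have "\<dots> = (x [^] (u * int p ^ b)) [^] v \<otimes> (x [^] (int p ^ a)) [^] w"
    using x by (simp add: int_pow_mult int_pow_pow)
  also have "\<dots> \<in> M"
    by (intro subgroup.m_closed[OF M] subgroup_int_pow_closed[OF M] x)
  finally show ?thesis .
qed

lemma int_p_decompose:
  assumes "\<not> int p ^ n dvd s"
  obtains t u where "s = u * int p ^ t" "\<not> int p dvd u" "t < n"
proof -
  have "s \<noteq> 0" using assms by auto
  moreover have "\<not> is_unit (int p)" using prime_int not_prime_unit by blast
  ultimately obtain u where u: "s = int p ^ multiplicity (int p) s * u" "\<not> int p dvd u"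
    using multiplicity_decompose'[of s "int p"] by blast
  moreover have "multiplicity (int p) s < n"
    using assms u(1) by (metis dvd_triv_left le_imp_power_dvd dvd_trans not_le)
  ultimately show thesis using that[of u "multiplicity (int p) s"] by (simp add: mult.commute)
qed

text \<open>Let B be the span of S. If a combination lies in p^m G, the coefficient of y must be
  divisible by p^min(m, n+1): otherwise a multiple of the relation would put p^n y into B + p^(n+1)
  G. The y-term then lies in p^m G itself, and removing it leaves a combination over S.\<close>

lemma pure_independent_insert:
  assumes S: "S \<subseteq> carrier G" "pure_independent gen S"
    and y: "y \<in> carrier G" "y [^] (int p ^ Suc n) = \<one>"
    and ny: "y [^] (int p ^ n) \<notin> lspan gen S <#> mults (Suc n)"
  shows "pure_independent gen (insert y S)"
  unfolding pure_independent_def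
proof (intro allI impI ballI)
  let ?B = "lspan gen S"
  have B: "subgroup ?B G" by (rule lspan_subgroup) simp
  have M: "subgroup (?B <#> mults (Suc n)) G" by (rule mult_subgroups[OF B mults_subgroup])
  fix c m i
  assume c: "Poly_Mapping.keys c \<subseteq> insert y S" "lincomb gen c \<in> mults m" and i: "i \<in> insert y S"
  define s where "s = Poly_Mapping.lookup c y"
  define c0 where "c0 = c - frag_cmul s (frag_of y)"
  have c0y: "Poly_Mapping.lookup c0 y = 0" by (simp add: c0_def s_def lookup_minus)
  have k0: "Poly_Mapping.keys c0 \<subseteq> S"
  proof
    fix x assume x: "x \<in> Poly_Mapping.keys c0"
    then have "x \<noteq> y" using c0y by (auto simp: in_keys_iff)
    moreover have "x \<in> Poly_Mapping.keys c"
      using x \<open>x \<noteq> y\<close> by (simp add: in_keys_iff c0_def lookup_minus)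
    ultimately show "x \<in> S" using c by blast
  qed
  have lc: "lincomb gen c0 = lincomb gen c \<otimes> inv (y [^] s)"
    using y by (simp add: c0_def lincomb_diff lincomb_cmul gen_def)
  have lc': "lincomb gen c = lincomb gen c0 \<otimes> y [^] s"
    using y by (simp add: lc lincomb_closed m_assoc)
  obtain g where g: "g \<in> carrier G" "lincomb gen c = g [^] (int p ^ m)"
    using c by (auto simp: mults_def)
  have dvd: "int p ^ min m (Suc n) dvd s"
  proof (rule ccontr)
    assume "\<not> ?thesis"
    then obtain t u where tu: "s = u * int p ^ t" "\<not> int p dvd u" "t < min m (Suc n)"
      by (rule int_p_decompose)
    \<comment> \<open>Multiplying the relation by p^(n-t) turns the y-term into u p^n y. The
      right-hand side moves to p^(m+n-t) G, which is inside p^(n+1) G because t < m.\<close>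
    have tn: "int p ^ t * int p ^ (n - t) = int p ^ n" using tu by (simp flip: power_add)
    have "lincomb gen c0 [^] (int p ^ (n - t)) \<otimes> y [^] (u * int p ^ n) = (lincomb gen c0 \<otimes> y [^] s) [^] (int p ^ (n - t))"
      using y tu tn by (simp add: int_pow_distrib int_pow_pow lincomb_closed mult.assoc)
    also have "\<dots> = g [^] (int p ^ (m + (n - t)))"
      using g y by (simp add: lc'[symmetric] int_pow_pow power_add)
    finally have eq: "y [^] (u * int p ^ n) = lincomb gen (frag_cmul (- (int p ^ (n - t))) c0) \<otimes> g [^] (int p ^ (m + (n - t)))"
      using g y by (simp add: lincomb_cmul lincomb_closed int_pow_neg)
        (metis int_pow_closed inv_solve_left' lincomb_closed gen_closed)
    have "lincomb gen (frag_cmul (- (int p ^ (n - t))) c0) \<in> ?B"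
      using k0 keys_cmul[of _ c0] by (fastforce simp: lspan_def)
    moreover have "g [^] (int p ^ (m + (n - t))) \<in> mults (m + (n - t))"
      using g by (simp add: mults_def)
    then have "g [^] (int p ^ (m + (n - t))) \<in> mults (Suc n)"
      by (rule subsetD[OF mults_antimono, rotated]) (use tu in linarith)
    ultimately have "y [^] (u * int p ^ n) \<in> ?B <#> mults (Suc n)"
      unfolding eq set_mult_def by blast
    moreover have "y [^] (int p ^ Suc n) \<in> ?B <#> mults (Suc n)"
      unfolding y(2) by (rule subgroup.one_closed[OF M])
    ultimately show False using pow_p_coprime[OF M y(1), of "Suc n" u n] tu(2) ny by simp
  qed
  have "y [^] s \<in> mults m"
  proof (cases "m \<le> Suc n")
    case True
    then obtain r where "s = int p ^ m * r" using dvd by (auto simp: min_def)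
    then have "s = r * int p ^ m" by (simp add: mult.commute)
    then have "y [^] s = (y [^] r) [^] (int p ^ m)" using y by (simp add: int_pow_pow)
    then show ?thesis using y by (auto simp: mults_def)
  next
    case False
    then obtain r where "s = int p ^ Suc n * r" using dvd by (auto simp: min_def)
    then have "y [^] s = (y [^] (int p ^ Suc n)) [^] r" using y(1) by (simp only: int_pow_pow)
    then show ?thesis using y(2) subgroup.one_closed[OF mults_subgroup] by simp
  qed
  then have c0m: "lincomb gen c0 \<in> mults m"
    unfolding lc using c subgroup.m_closed[OF mults_subgroup] subgroup.m_inv_closed[OF mults_subgroup] by blast
  show "int p ^ min m (expo (gen i)) dvd Poly_Mapping.lookup c i"
  proof (cases "i = y")
    case True
    have "int p ^ expo y dvd int p ^ Suc n" using pow_eq_one_iff[OF y(1)] y(2) by blast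
    then have "expo y \<le> Suc n" by (simp only: int_p_power_dvd_iff)
    then have "int p ^ min m (expo y) dvd int p ^ min m (Suc n)"
      by (intro le_imp_power_dvd) auto
    with dvd show ?thesis using True y by (simp add: s_def gen_def) (meson dvd_trans)
  next
    case False
    with i have "i \<in> S" by simp
    moreover have "Poly_Mapping.lookup c0 i = Poly_Mapping.lookup c i"
      using False by (simp add: c0_def lookup_minus)
    ultimately show ?thesis using pure_independentD[OF S(2) k0 c0m, of i] by simp
  qed
qed

text \<open>Zorn's lemma provides a maximal S with span B. If B + pG were not all of G, an element
  outside it with the least j such that p^j times it lies in B could be corrected by an element of B
  and then adjoined to S by \<open>pure_independent_insert\<close>.\<close>

lemma ex_pure_independent_cover:
  obtains S where "S \<subseteq> carrier G" "pure_independent gen S"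
    "\<And>x. x \<in> carrier G \<Longrightarrow> x \<in> lspan gen S <#> mults 1"
proof -
  define A where "A = {S. S \<subseteq> carrier G \<and> pure_independent gen S}"
  have "\<exists>S\<in>A. \<forall>Y\<in>A. S \<subseteq> Y \<longrightarrow> Y = S"
  proof (rule subset_Zorn')
    fix C assume C: "subset.chain A C"
    have CA: "C \<subseteq> A" using C by (simp add: subset_chain_def)
    have "pure_independent gen (\<Union>C)"
      unfolding pure_independent_def
    proof (intro allI impI ballI)
      fix c n i
      assume c: "Poly_Mapping.keys c \<subseteq> \<Union>C" "lincomb gen c \<in> mults n" and i: "i \<in> \<Union>C"
      \<comment> \<open>A relation involves finitely many indices, so it lives in a single member of
        the chain.\<close>
      obtain Y where "Y \<in> C" "insert i (Poly_Mapping.keys c) \<subseteq> Y"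
        using finite_subset_Union_chain[of "insert i (Poly_Mapping.keys c)" C A] c i C by auto
      then show "int p ^ min n (expo (gen i)) dvd Poly_Mapping.lookup c i"
        using pure_independentD[of gen Y c n i] CA c by (auto simp: A_def)
    qed
    with CA show "\<Union>C \<in> A" by (auto simp: A_def)
  qed
  then obtain S where S: "S \<subseteq> carrier G" "pure_independent gen S"
    and max: "\<And>Y. Y \<subseteq> carrier G \<Longrightarrow> pure_independent gen Y \<Longrightarrow> S \<subseteq> Y \<Longrightarrow> Y = S"
    by (auto simp: A_def)
  let ?B = "lspan gen S"
  let ?M = "?B <#> mults 1"
  have B: "subgroup ?B G" by (rule lspan_subgroup) simp
  have M: "subgroup ?M G" by (rule mult_subgroups[OF B mults_subgroup])
  have BM: "?B \<subseteq> ?M" and mM: "mults 1 \<subseteq> ?M"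
    by (rule subset_set_mult[OF B mults_subgroup])+
  have "x \<in> ?M" if x: "x \<in> carrier G" for x
  proof (rule ccontr)
    assume nx: "x \<notin> ?M"
    define Q where "Q j \<longleftrightarrow> (\<exists>y\<in>carrier G. y \<notin> ?M \<and> y [^] (int p ^ j) \<in> ?B)" for j
    have "x [^] (int p ^ expo x) \<in> ?B"
      using pow_eq_one_iff[OF x, of "int p ^ expo x"] subgroup.one_closed[OF B] by simp
    then have "Q (expo x)" using x nx by (auto simp: Q_def)
    define j where "j = (LEAST j. Q j)"
    have "Q j" unfolding j_def using \<open>Q (expo x)\<close> by (rule LeastI)
    then obtain y0 where y0: "y0 \<in> carrier G" "y0 \<notin> ?M" "y0 [^] (int p ^ j) \<in> ?B" by (auto simp: Q_def)
    have "j \<noteq> 0" using y0 BM by (auto intro: ccontr)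
    then obtain n where n: "j = Suc n" using not0_implies_Suc by blast
    have "y0 [^] (int p ^ j) \<in> mults j" using y0 by (auto simp: mults_def)
    then obtain b where b: "b \<in> ?B" "y0 [^] (int p ^ j) = b [^] (int p ^ j)"
      using lspan_pure_p[OF gen_closed S(2) y0(3)] by blast
    have bc: "b \<in> carrier G" using B b subgroup.mem_carrier by fast
    \<comment> \<open>By purity p^j y0 = p^j b with b in the span; subtracting b makes p^j kill the
      element and keeps it outside \<open>?M\<close>.\<close>
    define y where "y = y0 \<otimes> inv b"
    have y: "y \<in> carrier G" using y0 bc by (simp add: y_def)
    have y1: "y [^] (int p ^ Suc n) = \<one>"
      using b y0(1) bc by (simp add: y_def int_pow_distrib int_pow_inv n r_inv)
    have yM: "y \<notin> ?M"
    proof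
      assume "y \<in> ?M"
      then have "y \<otimes> b \<in> ?M" using b BM subgroup.m_closed[OF M] by blast
      moreover have "y \<otimes> b = y0" using y0 bc by (simp add: y_def m_assoc)
      ultimately show False using y0 by simp
    qed
    have "y [^] (int p ^ n) \<notin> ?B <#> mults (Suc n)"
    proof
      assume "y [^] (int p ^ n) \<in> ?B <#> mults (Suc n)"
      then obtain b1 g where b1: "b1 \<in> ?B" and g: "g \<in> carrier G"
        and eq: "y [^] (int p ^ n) = b1 \<otimes> g [^] (int p ^ Suc n)"
        by (auto simp: set_mult_def mults_def)
      have b1c: "b1 \<in> carrier G" using B b1 subgroup.mem_carrier by fast
      \<comment> \<open>If p^n y = b1 + p^(n+1) g, then z = y - pg is still outside
        \<open>?M\<close> and p^n z = b1 lies in the span, against the minimality of j =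
        n+1.\<close>
      define z where "z = y \<otimes> inv (g [^] int p)"
      have z: "z \<in> carrier G" using y g by (simp add: z_def)
      have "z [^] (int p ^ n) = b1"
        using y g eq b1c by (simp add: z_def int_pow_distrib int_pow_inv int_pow_pow m_assoc)
      moreover have "z \<notin> ?M"
      proof
        assume "z \<in> ?M"
        moreover have "g [^] int p \<in> ?M" using mM g by (auto simp: mults_def)
        ultimately have "z \<otimes> g [^] int p \<in> ?M" using subgroup.m_closed[OF M] by blast
        moreover have "z \<otimes> g [^] int p = y" using y g by (simp add: z_def m_assoc)
        ultimately show False using yM by simp
      qed
      ultimately have "Q n" using z b1 by (auto simp: Q_def)
      then have "j \<le> n" unfolding j_def by (rule Least_le)
      with n show False by simp
    qed
    then have "pure_independent gen (insert y S)"
      using pure_independent_insert[OF S y y1] by blast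
    then have "y \<in> S" using max[of "insert y S"] S y by auto
    then have "lincomb gen (frag_of y) \<in> ?B" unfolding lspan_def by (intro imageI) simp
    then show False using y yM BM by (auto simp: gen_def)
  qed
  with S that show thesis by blast
qed

text \<open>Since \<open>G = B + p\<^sup>NG\<close> for every basic subgroup \<open>B\<close>, a homomorphism on \<open>B\<close> with image of
  exponent \<open>p\<^sup>N\<close> extends to \<open>G\<close> by killing \<open>p\<^sup>NG\<close>; purity makes this well defined.\<close>
lemma extend_hom:
  assumes h: "\<And>i. h i \<in> carrier G" and pi: "pure_independent h I"
    and cov: "\<And>x. x \<in> carrier G \<Longrightarrow> x \<in> lspan h I <#> mults 1"
    and z: "\<And>i. z i \<in> carrier G" "\<And>i. i \<in> I \<Longrightarrow> expo (z i) \<le> min N (expo (h i))"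
  obtains f where "f \<in> hom G G" "\<And>c. Poly_Mapping.keys c \<subseteq> I \<Longrightarrow> f (lincomb h c) = lincomb z c"
proof -
  \<comment> \<open>\<open>R x c\<close> says that \<open>c\<close> gives coordinates of x modulo
    p^N G. The extension evaluates any such \<open>c\<close> on the family z.\<close>
  define R where "R x c \<longleftrightarrow> Poly_Mapping.keys c \<subseteq> I \<and> (\<exists>g\<in>mults N. x = lincomb h c \<otimes> g)" for x c
  have mc: "g \<in> carrier G" if "g \<in> mults N" for g
    using that subgroup.mem_carrier[OF mults_subgroup] by blast
  have uniq: "lincomb z c = lincomb z d" if Rc: "R x c" and Rd: "R x d" for x c d
  proof -
    obtain g g' where g: "g \<in> mults N" "g' \<in> mults N" "x = lincomb h c \<otimes> g" "x = lincomb h d \<otimes> g'"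
      using Rc Rd unfolding R_def by blast
    have ks: "Poly_Mapping.keys c \<subseteq> I" "Poly_Mapping.keys d \<subseteq> I"
      using Rc Rd unfolding R_def by blast+
    have "lincomb h (c - d) = g' \<otimes> inv g"
    proof -
      have car: "lincomb h c \<in> carrier G" "lincomb h d \<in> carrier G" "g \<in> carrier G" "g' \<in> carrier G"
        using g mc h by (auto simp: lincomb_closed)
      then have "lincomb h c = (lincomb h c \<otimes> g) \<otimes> inv g" by (simp add: m_assoc)
      also have "\<dots> = (lincomb h d \<otimes> g') \<otimes> inv g" using g by simp
      also have "\<dots> = (g' \<otimes> inv g) \<otimes> lincomb h d" using car by (simp add: m_ac)
      finally have "lincomb h c \<otimes> inv lincomb h d = g' \<otimes> inv g"
        using car by (simp add: m_assoc)
      then show ?thesis using h by (simp add: lincomb_diff)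
    qed
    then have "lincomb h (c - d) \<in> mults N"
      using g subgroup.m_closed[OF mults_subgroup] subgroup.m_inv_closed[OF mults_subgroup] by simp
    moreover have "Poly_Mapping.keys (c - d) \<subseteq> I" using ks keys_diff[of c d] by blast
    ultimately have "int p ^ min N (expo (h i)) dvd Poly_Mapping.lookup (c - d) i" if "i \<in> I" for i
      using pure_independentD[OF pi] that by blast
    \<comment> \<open>Here the bound on \<open>expo (z i)\<close> enters: the divisibility by
      p^min(N, \<open>expo (h i)\<close>) coming from purity is enough to kill every term of the
      z-combination.\<close>
    then have "int p ^ expo (z i) dvd Poly_Mapping.lookup (c - d) i" if "i \<in> I" for i
      using that z(2)[OF that] by (meson dvd_trans le_imp_power_dvd)
    then have "lincomb z (c - d) = \<one>"
      using \<open>Poly_Mapping.keys (c - d) \<subseteq> I\<close> by (intro lincomb_eq_one z(1)) blast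
    then show ?thesis using z(1) by (simp add: lincomb_diff lincomb_closed) (metis inv_closed inv_equality inv_inv lincomb_closed)
  qed
  have ex: "\<exists>c. R x c" if x: "x \<in> carrier G" for x
  proof -
    obtain b g where "b \<in> lspan h I" "g \<in> carrier G" "x = b \<otimes> g [^] (int p ^ N)"
      using add_mults_cover[OF lspan_subgroup[of h, OF h] cov x] by blast
    then show ?thesis by (auto simp: R_def lspan_def mults_def)
  qed
  define f where "f x = lincomb z (SOME c. R x c)" for x
  have f: "f x = lincomb z c" if "R x c" for x c
    unfolding f_def using uniq[OF someI[of "R x", OF that] that] .
  show thesis
  proof
    show "f \<in> hom G G"
    proof (rule homI)
      fix x assume "x \<in> carrier G"
      then show "f x \<in> carrier G" by (simp add: f_def lincomb_closed z(1))
    next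
      fix x y assume xy: "x \<in> carrier G" "y \<in> carrier G"
      obtain c d where cd: "R x c" "R y d" using ex xy by blast
      then obtain g g' where g: "g \<in> mults N" "g' \<in> mults N" "x = lincomb h c \<otimes> g" "y = lincomb h d \<otimes> g'"
        and ks: "Poly_Mapping.keys c \<subseteq> I" "Poly_Mapping.keys d \<subseteq> I"
        by (auto simp: R_def)
      have "x \<otimes> y = lincomb h (c + d) \<otimes> (g \<otimes> g')"
        using g mc h by (simp add: lincomb_add lincomb_closed m_ac)
      moreover have "g \<otimes> g' \<in> mults N" using g subgroup.m_closed[OF mults_subgroup] by simp
      moreover have "Poly_Mapping.keys (c + d) \<subseteq> I" using ks keys_add[of c d] by blast
      ultimately have "R (x \<otimes> y) (c + d)" by (auto simp: R_def)
      with cd show "f (x \<otimes> y) = f x \<otimes> f y" by (simp add: f lincomb_add z(1))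
    qed
    show "f (lincomb h c) = lincomb z c" if "Poly_Mapping.keys c \<subseteq> I" for c
    proof (rule f)
      show "R (lincomb h c) c"
        unfolding R_def using that h subgroup.one_closed[OF mults_subgroup[of N]]
        by (intro conjI bexI[of _ \<one>]) (auto simp: lincomb_closed)
    qed
  qed
qed

end

section \<open>Pierce's condition for large subgroups\<close>

context p_torsion_group
begin

lemma lincomb_delta:
  assumes "w \<in> carrier G"
  shows "lincomb (\<lambda>i. if i = j then w else \<one>) c = w [^] Poly_Mapping.lookup c j"
proof -
  have "Poly_Mapping.keys c \<subseteq> UNIV" by simp
  then show ?thesis
    using assms by (induction c rule: frag_induction)
      (simp_all add: lincomb_diff lincomb_closed lookup_minus int_pow_diff)
qed

lemma expo_le_iff: "expo x \<le> n \<longleftrightarrow> x [^] (int p ^ n) = \<one>" if "x \<in> carrier G"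
proof -
  have "expo x \<le> n \<longleftrightarrow> int p ^ expo x dvd int p ^ n"
    by (simp add: int_p_power_dvd_iff)
  then show ?thesis using pow_eq_one_iff[OF that] by simp
qed

lemma expo_one [simp]: "expo \<one> = 0"
  using expo_le_iff[of \<one> 0] by simp

lemma fully_invariantD: "fully_invariant L G \<Longrightarrow> f \<in> hom G G \<Longrightarrow> x \<in> L \<Longrightarrow> f x \<in> L"
  unfolding fully_invariant_def by blast

section \<open>Endomorphisms prescribed on a maximal pure-independent set\<close>

context
  fixes S :: "'a set"
  assumes S: "S \<subseteq> carrier G" "pure_independent gen S"
    and cov: "\<And>x. x \<in> carrier G \<Longrightarrow> x \<in> lspan gen S <#> mults 1"
begin

text \<open>\<open>extend_hom\<close> applies with N the exponent of x, because the coordinate map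
  of the basic subgroup has its image in the finite cyclic group generated by x.\<close>

lemma projection:
  assumes "x \<in> S"
  obtains f where "f \<in> hom G G"
    "\<And>c. Poly_Mapping.keys c \<subseteq> S \<Longrightarrow> f (lincomb gen c) = gen x [^] Poly_Mapping.lookup c x"
proof -
  obtain f where f: "f \<in> hom G G"
    "\<And>c. Poly_Mapping.keys c \<subseteq> S \<Longrightarrow>
      f (lincomb gen c) = lincomb (\<lambda>i. if i = x then gen x else \<one>) c"
    by (rule extend_hom[of gen S "\<lambda>i. if i = x then gen x else \<one>" "expo (gen x)"])
      (use S cov in auto)
  with that show thesis by (simp add: lincomb_delta)
qed

text \<open>Let n = \<open>expo x\<close> and y = p^n y'. Then w = p^k y' satisfies p^n w = p^k y =
  0, so some endomorphism sends x to w. It sends p^(n-k) x to p^n y' = y.\<close>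

lemma fully_invariant_contains_deep:
  assumes L: "fully_invariant L G" and x: "x \<in> S" "k \<le> expo x" "x [^] (int p ^ (expo x - k)) \<in> L"
    and y: "y \<in> mults (expo x)" "y [^] (int p ^ k) = \<one>"
  shows "y \<in> L"
proof -
  let ?n = "expo x"
  have xc: "x \<in> carrier G" "gen x = x" using S x by (auto simp: gen_def)
  obtain y' where y': "y' \<in> carrier G" "y = y' [^] (int p ^ ?n)" using y by (auto simp: mults_def)
  define w where "w = y' [^] (int p ^ k)"
  have w: "w \<in> carrier G" using y' by (simp add: w_def)
  have "w [^] (int p ^ ?n) = \<one>"
    using y y' by (simp add: w_def int_pow_pow mult.commute)
  then have ew: "expo w \<le> ?n" using expo_le_iff[OF w] by simp
  obtain f where f: "f \<in> hom G G"
    "\<And>c. Poly_Mapping.keys c \<subseteq> S \<Longrightarrow> f (lincomb gen c) = lincomb (\<lambda>i. if i = x then w else \<one>) c"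
    by (rule extend_hom[of gen S "\<lambda>i. if i = x then w else \<one>" ?n])
      (use S cov w ew xc in auto)
  have "f x = w" using f(2)[of "frag_of x"] xc w x by (simp add: lincomb_delta)
  have "y = w [^] (int p ^ (?n - k))"
    using y' x by (simp add: w_def int_pow_pow flip: power_add)
  also have "\<dots> = f (x [^] (int p ^ (?n - k)))"
    using hom_int_pow[OF f(1) xc(1) group_axioms group_axioms] \<open>f x = w\<close> by simp
  also have "\<dots> \<in> L" by (rule fully_invariantD[OF L f(1) x(3)])
  finally show ?thesis .
qed

end

text \<open>Given members \<open>s 0, s 1, \<dots>\<close> of \<open>S\<close> of strictly increasing orders \<open>p ^ e i\<close>, the family
  \<open>twist\<close> replaces \<open>s i\<close> by \<open>s i - p ^ (e (i + 1) - e i) s (i + 1)\<close>. It spans a basic subgroup whose quotient in the span of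
  \<open>S\<close> is a copy of \<open>\<int>(p\<^sup>\<infinity>)\<close>, into which \<open>s 0\<close> maps with its full order.\<close>
definition twist_coeff :: "(nat \<Rightarrow> 'a) \<Rightarrow> 'a \<Rightarrow> 'a \<Rightarrow>\<^sub>0 int"
  where "twist_coeff s x = (if x \<in> range s
    then frag_of x - frag_cmul (int p ^ (expo (s (Suc (inv_into UNIV s x))) - expo x)) (frag_of (s (Suc (inv_into UNIV s x))))
    else frag_of x)"

definition twist :: "(nat \<Rightarrow> 'a) \<Rightarrow> 'a \<Rightarrow> 'a"
  where "twist s x = lincomb gen (twist_coeff s x)"

lemma twist_closed [simp]: "twist s x \<in> carrier G"
  by (simp add: twist_def lincomb_closed)

lemma lincomb_twist: "lincomb (twist s) c = lincomb gen (frag_extend (twist_coeff s) c)"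
  by (simp add: lincomb_frag_extend twist_def[abs_def])

section \<open>The twisted family spans a basic subgroup\<close>

context
  fixes S :: "'a set" and s :: "nat \<Rightarrow> 'a"
  assumes S: "S \<subseteq> carrier G" "pure_independent gen S"
    and cov: "\<And>x. x \<in> carrier G \<Longrightarrow> x \<in> lspan gen S <#> mults 1"
    and s: "\<And>i. s i \<in> S" and expo_less: "\<And>i. expo (s i) < expo (s (Suc i))"
begin

lemma s_carrier [simp]: "s i \<in> carrier G" "gen (s i) = s i"
  using S s[of i] by (auto simp: gen_def)

lemma s_inj: "inj s"
proof -
  have "strict_mono (\<lambda>i. expo (s i))" using expo_less by (simp add: strict_mono_Suc_iff)
  then show ?thesis by (metis (no_types, lifting) injI strict_mono_eq)
qed

lemma twist_coeff_s:
  "twist_coeff s (s i) = frag_of (s i) - frag_cmul (int p ^ (expo (s (Suc i)) - expo (s i))) (frag_of (s (Suc i)))"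
  using s_inj by (simp add: twist_coeff_def)

lemma twist_s: "twist s (s i) = s i \<otimes> inv (s (Suc i) [^] (int p ^ (expo (s (Suc i)) - expo (s i))))"
  by (simp add: twist_def twist_coeff_s lincomb_diff lincomb_cmul)

lemma twist_other: "x \<notin> range s \<Longrightarrow> twist s x = gen x"
  by (simp add: twist_def twist_coeff_def)

text \<open>The change of coordinates is triangular along the chain, so coefficients over
  \<open>twist s\<close> can be recovered step by step, upwards from \<open>s 0\<close> or downwards
  from a vanishing one.\<close>

lemma lookup_twist_Suc:
  "Poly_Mapping.lookup (frag_extend (twist_coeff s) c) (s (Suc i)) = Poly_Mapping.lookup c (s (Suc i))
    - int p ^ (expo (s (Suc i)) - expo (s i)) * Poly_Mapping.lookup c (s i)"
proof -
  have "Poly_Mapping.keys c \<subseteq> UNIV" by simp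
  then show ?thesis
  proof (induction c rule: frag_induction)
    case (one x)
    show ?case
    proof (cases "x \<in> range s")
      case True
      then obtain j where "x = s j" by blast
      then show ?thesis using s_inj by (auto simp: twist_coeff_s lookup_minus inj_eq)
    qed (auto simp: twist_coeff_def)
  qed (auto simp: frag_extend_diff lookup_minus algebra_simps)
qed

lemma lookup_twist_0:
  "Poly_Mapping.lookup (frag_extend (twist_coeff s) c) (s 0) = Poly_Mapping.lookup c (s 0)"
proof -
  have "Poly_Mapping.keys c \<subseteq> UNIV" by simp
  then show ?thesis
  proof (induction c rule: frag_induction)
    case (one x)
    show ?case
    proof (cases "x \<in> range s")
      case True
      then obtain j where "x = s j" by blast
      then show ?thesis using s_inj by (auto simp: twist_coeff_s lookup_minus inj_eq)
    qed (auto simp: twist_coeff_def)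
  qed (auto simp: frag_extend_diff lookup_minus)
qed

lemma lookup_twist_other:
  assumes "y \<notin> range s"
  shows "Poly_Mapping.lookup (frag_extend (twist_coeff s) c) y = Poly_Mapping.lookup c y"
proof -
  have "Poly_Mapping.keys c \<subseteq> UNIV" by simp
  then show ?thesis
  proof (induction c rule: frag_induction)
    case (one x)
    show ?case using assms by (auto simp: twist_coeff_def lookup_minus)
  qed (auto simp: frag_extend_diff lookup_minus)
qed

lemma keys_twist: "Poly_Mapping.keys (frag_extend (twist_coeff s) c) \<subseteq> S"
  if "Poly_Mapping.keys c \<subseteq> S"
proof
  fix y assume y: "y \<in> Poly_Mapping.keys (frag_extend (twist_coeff s) c)"
  show "y \<in> S"
  proof (cases "y \<in> range s")
    case False
    then show ?thesis using y that by (auto simp: in_keys_iff lookup_twist_other)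
  qed (use s in auto)
qed

text \<open>The factor p^(e(i+1) - e(i)) lowers the order of s(i+1) to that of s(i), so the
  correction does not raise the exponent.\<close>

lemma expo_twist: "expo (twist s x) \<le> expo (gen x)"
proof (cases "x \<in> range s")
  case True
  then obtain i where i: "x = s i" by blast
  have "(s (Suc i) [^] (int p ^ (expo (s (Suc i)) - expo (s i)))) [^] (int p ^ expo (s i))
      = s (Suc i) [^] (int p ^ expo (s (Suc i)))"
    using expo_less[of i] by (simp add: int_pow_pow flip: power_add)
  also have "\<dots> = \<one>" using pow_eq_one_iff by simp
  finally show ?thesis
    using i pow_eq_one_iff[of "s i" "int p ^ expo (s i)"]
    by (simp add: expo_le_iff twist_s int_pow_distrib int_pow_inv)
qed (simp add: twist_other)

text \<open>Divisibility holds for the coordinates over \<open>gen\<close> and is carried to those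
  over \<open>twist s\<close> by induction along the chain: the factor p^(e(i+1) - e(i)) of the
  correction compensates for the smaller exponent known at s(i).\<close>

lemma twist_pure_independent: "pure_independent (twist s) S"
  unfolding pure_independent_def
proof (intro allI impI ballI)
  fix c n x
  assume c: "Poly_Mapping.keys c \<subseteq> S" "lincomb (twist s) c \<in> mults n" and x: "x \<in> S"
  let ?D = "frag_extend (twist_coeff s) c"
  have D: "int p ^ min n (expo (gen y)) dvd Poly_Mapping.lookup ?D y" if "y \<in> S" for y
    using pure_independentD[OF S(2) keys_twist[OF c(1)] _ that] c(2) by (simp add: lincomb_twist)
  have *: "int p ^ min n (expo (s i)) dvd Poly_Mapping.lookup c (s i)" for i
  proof (induction i)
    case 0
    then show ?case using D[OF s[of 0]] by (simp add: lookup_twist_0)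
  next
    case (Suc i)
    let ?d = "expo (s (Suc i)) - expo (s i)"
    have "min n (expo (s (Suc i))) \<le> ?d + min n (expo (s i))" using expo_less[of i] by auto
    then have "int p ^ min n (expo (s (Suc i))) dvd int p ^ ?d * int p ^ min n (expo (s i))"
      by (simp add: le_imp_power_dvd flip: power_add)
    also have "\<dots> dvd int p ^ ?d * Poly_Mapping.lookup c (s i)" using Suc.IH by (rule mult_dvd_mono[OF dvd_refl])
    finally have 2: "int p ^ min n (expo (s (Suc i))) dvd int p ^ ?d * Poly_Mapping.lookup c (s i)" .
    have 1: "int p ^ min n (expo (s (Suc i))) dvd
        Poly_Mapping.lookup c (s (Suc i)) - int p ^ ?d * Poly_Mapping.lookup c (s i)"
      using D[OF s[of "Suc i"]] by (simp add: lookup_twist_Suc)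
    show ?case using dvd_add[OF 1 2] by simp
  qed
  have "int p ^ min n (expo (gen x)) dvd Poly_Mapping.lookup c x"
  proof (cases "x \<in> range s")
    case True
    then show ?thesis using * by auto
  next
    case False
    then show ?thesis using D[OF x] by (simp add: lookup_twist_other)
  qed
  then show "int p ^ min n (expo (twist s x)) dvd Poly_Mapping.lookup c x"
    using expo_twist[of x] by (meson dvd_trans le_imp_power_dvd min.mono order_refl)
qed

text \<open>Since the exponents increase strictly, s(i) differs from its twist by an element of pG.
  Hence the span of \<open>gen\<close> lies in the span of the twisted family plus pG.\<close>

lemma twist_cover: "x \<in> lspan (twist s) S <#> mults 1" if x: "x \<in> carrier G"
proof -
  let ?B = "lspan (twist s) S"
  let ?M = "?B <#> mults 1"
  have B: "subgroup ?B G" by (rule lspan_subgroup) simp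
  have M: "subgroup ?M G" by (rule mult_subgroups[OF B mults_subgroup])
  have BM: "?B \<subseteq> ?M" and mM: "mults 1 \<subseteq> ?M"
    by (rule subset_set_mult[OF B mults_subgroup])+
  have tB: "twist s y \<in> ?B" if "y \<in> S" for y
  proof -
    have "lincomb (twist s) (frag_of y) \<in> ?B" unfolding lspan_def by (intro imageI) (use that in simp)
    then show ?thesis by simp
  qed
  have "gen y \<in> ?M" if y: "y \<in> S" for y
  proof (cases "y \<in> range s")
    case True
    then obtain i where i: "y = s i" by blast
    let ?d = "expo (s (Suc i)) - expo (s i)"
    have "int p ^ ?d = int p ^ (?d - 1) * int p"
      using expo_less[of i] by (metis Suc_diff_1 mult.commute power_Suc zero_less_diff)
    then have "s (Suc i) [^] (int p ^ ?d) = (s (Suc i) [^] (int p ^ (?d - 1))) [^] int p"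
      by (simp only: int_pow_pow s_carrier)
    then have "s (Suc i) [^] (int p ^ ?d) \<in> mults 1" by (simp add: mults_def)
    then have "twist s y \<otimes> s (Suc i) [^] (int p ^ ?d) \<in> ?M"
      using tB[OF y] by (auto simp: set_mult_def)
    then show ?thesis by (simp add: i twist_s m_assoc)
  next
    case False
    then show ?thesis using tB[OF y] BM by (auto simp: twist_other)
  qed
  then have "lspan gen S \<subseteq> ?M" by (intro lspan_least M) auto
  moreover obtain a b where "a \<in> lspan gen S" "b \<in> mults 1" "x = a \<otimes> b"
    using cov[OF x] by (auto simp: set_mult_def)
  ultimately show ?thesis using mM subgroup.m_closed[OF M, of a b] by blast
qed

text \<open>This expresses that s(0) keeps its full order modulo the twisted span: the divisibility
  hypothesis says that p^k annihilates s(0) minus an element of that span. Descending along the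
  chain, p^e(i) divides p^k times the coefficient at s(i); at s(0) the additional coefficient 1
  leaves p^e(0) dividing p^k.\<close>

lemma expo_le_if_multiple_in_twist:
  assumes c: "Poly_Mapping.keys c \<subseteq> S"
    and d: "d = frag_of (s 0) - frag_extend (twist_coeff s) c"
    and dvd: "\<And>x. x \<in> S \<Longrightarrow> int p ^ expo x dvd int p ^ k * Poly_Mapping.lookup d x"
  shows "expo (s 0) \<le> k"
proof -
  let ?c = "\<lambda>i. Poly_Mapping.lookup c (s i)"
  \<comment> \<open>Finite support of \<open>c\<close> gives an index with vanishing coefficient,
    from which the descent starts.\<close>
  have "infinite (range s)" using s_inj by (simp add: range_inj_infinite)
  then obtain n where n: "?c n = 0"
    using finite_subset[OF _ finite_keys[of c], of "range s"] by (auto simp: in_keys_iff subset_iff)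
  have "int p ^ expo (s (n - j)) dvd int p ^ k * ?c (n - j)" if "j \<le> n" for j
    using that
  proof (induction j)
    case (Suc j)
    define i where "i = n - Suc j"
    have i: "n - j = Suc i" using Suc.prems by (simp add: i_def)
    let ?d = "expo (s (Suc i)) - expo (s i)"
    have "Poly_Mapping.lookup d (s (Suc i)) = int p ^ ?d * ?c i - ?c (Suc i)"
      using s_inj by (auto simp: d lookup_minus lookup_twist_Suc inj_eq)
    then have "int p ^ expo (s (Suc i)) dvd int p ^ k * (int p ^ ?d * ?c i) - int p ^ k * ?c (Suc i)"
      using dvd[OF s[of "Suc i"]] by (simp add: right_diff_distrib)
    moreover have "int p ^ expo (s (Suc i)) dvd int p ^ k * ?c (Suc i)"
      using Suc i by simp
    ultimately have "int p ^ expo (s (Suc i)) dvd int p ^ k * (int p ^ ?d * ?c i)"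
      by (metis diff_add_cancel dvd_add)
    also have "int p ^ k * (int p ^ ?d * ?c i) = int p ^ ?d * (int p ^ k * ?c i)" by (simp add: ac_simps)
    also have "int p ^ expo (s (Suc i)) = int p ^ ?d * int p ^ expo (s i)"
      using expo_less[of i] by (simp flip: power_add)
    finally show ?case using prime_int unfolding i_def[symmetric] by simp
  qed (simp add: n)
  from this[of n] have "int p ^ expo (s 0) dvd int p ^ k * ?c 0" by simp
  moreover have "int p ^ expo (s 0) dvd int p ^ k * (1 - ?c 0)"
    using dvd[OF s[of 0]] by (simp add: d lookup_minus lookup_twist_0)
  ultimately have "int p ^ expo (s 0) dvd int p ^ k * ?c 0 + int p ^ k * (1 - ?c 0)" by (rule dvd_add)
  then have "int p ^ expo (s 0) dvd int p ^ k" by (simp add: algebra_simps)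
  then show ?thesis by (simp add: int_p_power_dvd_iff)
qed

end

section \<open>The case distinction that proves Pierce's condition\<close>

lemma large_subgroup_contains_deep:
  assumes L: "large_subgroup L G"
  obtains m where "\<And>x. x \<in> mults m \<Longrightarrow> x [^] (int p ^ k) = \<one> \<Longrightarrow> x \<in> L"
proof -
  have fi: "fully_invariant L G" and LB: "\<And>B. basic_subgroup B G \<Longrightarrow> carrier G = L <#> B"
    using L by (auto simp: large_subgroup_def)
  have Ls: "subgroup L G" using fi by (simp add: fully_invariant_def)
  obtain S where S: "S \<subseteq> carrier G" "pure_independent gen S"
    and cov: "\<And>x. x \<in> carrier G \<Longrightarrow> x \<in> lspan gen S <#> mults 1"
    using ex_pure_independent_cover by blast
  have gS: "gen x = x" "x \<in> carrier G" if "x \<in> S" for x using that S by (auto simp: gen_def)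
  \<comment> \<open>The cases are split at k+1 rather than k: in the last one all exponents of the
    chain are at least k+1, which contradicts the bound \<open>expo (s 0) \<le> k\<close> reached
    there.\<close>
  let ?K = "Suc k"
  consider M where "\<And>x. x \<in> S \<Longrightarrow> expo x \<le> M"
    | x where "x \<in> S" "?K \<le> expo x" "x [^] (int p ^ (expo x - ?K)) \<in> L"
    | "\<And>M. \<exists>x\<in>S. M < expo x" "\<And>x. x \<in> S \<Longrightarrow> ?K \<le> expo x \<Longrightarrow> x [^] (int p ^ (expo x - ?K)) \<notin> L"
    by (meson not_le)
  then show thesis
  proof cases
    case 1
    have "x \<in> L" if xM: "x \<in> mults M" for x
    proof -
      obtain g where g: "g \<in> carrier G" "x = g [^] (int p ^ M)" using xM by (auto simp: mults_def)
      have "basic_subgroup (lspan gen S) G" by (rule basic_subgroup_lspan[OF _ S(2) cov]) simp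
      then obtain l c where l: "l \<in> L" and c: "Poly_Mapping.keys c \<subseteq> S" "g = l \<otimes> lincomb gen c"
        using LB g by (auto simp: set_mult_def lspan_def)
      \<comment> \<open>All generators have exponent at most M, so p^M kills the basic component of
        g and p^M g = p^M l.\<close>
      have "lincomb gen (frag_cmul (int p ^ M) c) = \<one>"
        using c 1 gS by (intro lincomb_eq_one) (auto intro!: dvd_mult2 le_imp_power_dvd simp: subset_iff)
      then have "x = l [^] (int p ^ M)"
        using g c l subgroup.mem_carrier[OF Ls] by (simp add: int_pow_distrib lincomb_cmul lincomb_closed)
      then show ?thesis using subgroup_int_pow_closed[OF Ls l] by simp
    qed
    then show thesis using that by blast
  next
    case 2
    have "y \<in> L" if "y \<in> mults (expo x)" "y [^] (int p ^ k) = \<one>" for y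
    proof (rule fully_invariant_contains_deep[OF S cov fi 2 that(1)])
      have "y \<in> carrier G" using that subgroup.mem_carrier[OF mults_subgroup] by blast
      then have "y [^] (int p ^ ?K) = (y [^] (int p ^ k)) [^] int p"
        by (simp add: int_pow_pow mult.commute)
      then show "y [^] (int p ^ ?K) = \<one>" using that by simp
    qed
    then show thesis using that by blast
  next
    case 3
    have "\<exists>s. \<forall>n. (s n \<in> S \<and> ?K \<le> expo (s n)) \<and> expo (s n) < expo (s (Suc n))"
    proof (rule dependent_nat_choice)
      show "\<exists>x. x \<in> S \<and> ?K \<le> expo x" using 3(1)[of ?K] by (meson less_imp_le)
      fix x n assume "x \<in> S \<and> ?K \<le> expo x"
      then show "\<exists>y. (y \<in> S \<and> ?K \<le> expo y) \<and> expo x < expo y"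
        using 3(1)[of "expo x"] by (meson less_imp_le order_trans)
    qed
    then obtain s where s: "\<And>n. s n \<in> S" "\<And>n. ?K \<le> expo (s n)" "\<And>n. expo (s n) < expo (s (Suc n))"
      by blast
    have "basic_subgroup (lspan (twist s) S) G"
      by (rule basic_subgroup_lspan)
        (use twist_pure_independent[where S = S and s = s, OF S cov s(1,3)] twist_cover[where S = S and s = s, OF S cov s(1,3)] in auto)
    then have "s 0 \<in> L <#> lspan (twist s) S" using LB gS(2)[OF s(1)[of 0]] by blast
    then obtain l c where l: "l \<in> L" and c: "Poly_Mapping.keys c \<subseteq> S" "s 0 = l \<otimes> lincomb (twist s) c"
      by (auto simp: set_mult_def lspan_def)
    have lc: "l \<in> carrier G" using l subgroup.mem_carrier[OF Ls] by blast
    define d where "d = frag_of (s 0) - frag_extend (twist_coeff s) c"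
    have "Poly_Mapping.keys d \<subseteq> S"
      using s(1)[of 0] keys_twist[where S = S and s = s, OF S cov s(1,3) c(1)] keys_diff[of "frag_of (s 0)" "frag_extend (twist_coeff s) c"]
      by (auto simp: d_def)
    have "l = lincomb gen d"
      using lc c(2) gS(1)[OF s(1)[of 0]]
      by (simp add: d_def lincomb_diff lincomb_twist lincomb_closed m_assoc)
    \<comment> \<open>Projecting l puts its x-component into L. If p^k did not kill this component,
      L would contain p^t x for some t \<le> \<open>expo x - ?K\<close>, and hence the multiple of x
      excluded in this case.\<close>
    have "int p ^ expo x dvd int p ^ k * Poly_Mapping.lookup d x" if x: "x \<in> S" for x
    proof (rule ccontr)
      assume nd: "\<not> ?thesis"
      then have "\<not> expo x \<le> k" by (meson dvd_mult2 le_imp_power_dvd)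
      then have kx: "?K \<le> expo x" by simp
      obtain f where f: "f \<in> hom G G"
        "\<And>c. Poly_Mapping.keys c \<subseteq> S \<Longrightarrow> f (lincomb gen c) = gen x [^] Poly_Mapping.lookup c x"
        using projection[OF S cov x] by blast
      have xl: "x [^] Poly_Mapping.lookup d x \<in> L"
        using fully_invariantD[OF fi f(1) l] f(2)[OF \<open>Poly_Mapping.keys d \<subseteq> S\<close>] gS[OF x]
          \<open>l = lincomb gen d\<close> by simp
      have "\<not> int p ^ (expo x - k) dvd Poly_Mapping.lookup d x"
      proof
        assume "int p ^ (expo x - k) dvd Poly_Mapping.lookup d x"
        then have "int p ^ k * int p ^ (expo x - k) dvd int p ^ k * Poly_Mapping.lookup d x"
          by (rule mult_dvd_mono[OF dvd_refl])
        then show False using nd kx by (simp flip: power_add)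
      qed
      then obtain t u where tu: "Poly_Mapping.lookup d x = u * int p ^ t" "\<not> int p dvd u" "t < expo x - k"
        by (rule int_p_decompose)
      have "x [^] (int p ^ expo x) \<in> L"
        using pow_eq_one_iff[OF gS(2)[OF x], of "int p ^ expo x"] subgroup.one_closed[OF Ls] by simp
      then have "x [^] (int p ^ t) \<in> L"
        using pow_p_coprime[OF Ls gS(2)[OF x], of "expo x" u t] xl tu by simp
      then have "(x [^] (int p ^ t)) [^] (int p ^ (expo x - ?K - t)) \<in> L"
        by (rule subgroup_int_pow_closed[OF Ls])
      then have "x [^] (int p ^ (expo x - ?K)) \<in> L"
        using gS(2)[OF x] tu by (simp add: int_pow_pow flip: power_add)
      then show False using 3(2)[OF x kx] by simp
    qed
    then have "expo (s 0) \<le> k"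
      by (intro expo_le_if_multiple_in_twist[where S = S and s = s, OF S cov s(1,3) c(1) d_def])
    then show thesis using s(2)[of 0] by simp
  qed
qed

end

section \<open>Finite ordinals and \<open>\<omega>\<close>\<close>

definition fin_ord :: "nat \<Rightarrow> 'a ordinal"
  where "fin_ord n = (osucc ^^ n) 0"

definition omega :: "'a ordinal"
  where "omega = (LEAST x. \<forall>n. fin_ord n < x)"

lemma fin_ord_0 [simp]: "fin_ord 0 = 0"
  and fin_ord_Suc: "fin_ord (Suc n) = osucc (fin_ord n)"
  by (simp_all add: fin_ord_def)

lemma less_osucc_iff: "x < osucc y \<longleftrightarrow> x \<le> y"
  using osucc_le_iff[of y x] by (meson not_le)

lemma fin_ord_strict_mono: "strict_mono fin_ord"
  by (simp add: strict_mono_Suc_iff fin_ord_Suc osucc_greater)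

lemma le_fin_ordD: "x \<le> fin_ord n \<Longrightarrow> \<exists>m. x = fin_ord m"
proof (induction n)
  case 0
  then show ?case using ordinal_zero_le[of x] by (intro exI[of _ 0]) simp
next
  case (Suc n)
  show ?case
  proof (cases "x = fin_ord (Suc n)")
    case False
    then have "x \<le> fin_ord n" using Suc.prems by (simp add: fin_ord_Suc less_osucc_iff order_le_less)
    then show ?thesis by (rule Suc.IH)
  qed blast
qed

text \<open>If the finite ordinals were cofinal they would be all ordinals, and
  \<open>'a ordinal\<close> would embed into \<open>nat\<close>. The summand \<open>nat\<close> in
  \<open>'a + nat\<close> makes this impossible even for finite \<open>'a\<close>.\<close>

lemma fin_ord_less_omega: "fin_ord n < (omega :: 'a ordinal)"
proof -
  have "\<exists>x :: 'a ordinal. \<forall>n. fin_ord n < x"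
  proof (rule ccontr)
    assume "\<not> ?thesis"
    then have "\<exists>n. x = fin_ord n" for x :: "'a ordinal"
      using le_fin_ordD not_le by blast
    then have "surj (fin_ord :: nat \<Rightarrow> 'a ordinal)" by (auto simp: surj_def)
    then have "inj (inv_into UNIV (fin_ord :: nat \<Rightarrow> 'a ordinal))" by (rule surj_imp_inj_inv)
    then have "inj (Inr \<circ> inv_into UNIV (fin_ord :: nat \<Rightarrow> 'a ordinal) :: 'a ordinal \<Rightarrow> 'a + nat)"
      by (simp add: inj_compose)
    then show False using ordinal_no_embedding by blast
  qed
  then have "\<forall>n. fin_ord n < (omega :: 'a ordinal)" unfolding omega_def by (rule LeastI_ex)
  then show ?thesis ..
qed

lemma less_omegaD: "x < omega \<Longrightarrow> \<exists>n. x = fin_ord n"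
proof -
  assume "x < omega"
  then have "\<not> (\<forall>n. fin_ord n < x)" unfolding omega_def by (rule not_less_Least)
  then show "\<exists>n. x = fin_ord n" using le_fin_ordD by (auto simp: not_less)
qed

lemma is_limit_omega: "is_limit omega"
proof -
  have False if "omega = osucc y" for y :: "'a ordinal"
  proof -
    have "y < omega" using that osucc_greater by metis
    then obtain n where "y = fin_ord n" using less_omegaD by blast
    then show False using fin_ord_less_omega[of "Suc n"] that by (metis fin_ord_Suc less_irrefl)
  qed
  moreover have "omega \<noteq> (0 :: 'a ordinal)" using fin_ord_less_omega[of 0] by (metis fin_ord_0 less_irrefl)
  ultimately show ?thesis unfolding is_limit_def by blast
qed

lemma ordinal_cases:
  obtains "x = (0 :: 'a ordinal)" | y where "x = osucc y" | "is_limit x"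
  unfolding is_limit_def by blast

lemma ppower_omega:
  fixes G :: "('a, 'm) monoid_scheme"
  shows "ppower p G omega = (\<Inter>n. ppower p G (fin_ord n))"
proof -
  have "{..<omega} = range (fin_ord :: nat \<Rightarrow> 'a ordinal)" by (auto simp: fin_ord_less_omega dest: less_omegaD)
  then show ?thesis by (simp add: ppower_limit[OF is_limit_omega])
qed

lemma ppower_fin_ord_stationary:
  assumes "ppower p G (fin_ord n) = ppower p G (osucc (fin_ord n))" "n \<le> m"
  shows "ppower p G (fin_ord m) = ppower p G (fin_ord n)"
  using assms(2)
proof (induction m rule: dec_induct)
  case (step m)
  then show ?case using assms(1) by (metis fin_ord_Suc ppower_succ)
qed simp

lemma (in comm_group) ppower_stationary_omega:
  assumes "ppower p G (fin_ord n) = ppower p G (osucc (fin_ord n))"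
  shows "ppower p G omega = ppower p G (fin_ord n)"
proof
  show "ppower p G omega \<subseteq> ppower p G (fin_ord n)" by (auto simp: ppower_omega)
  have "ppower p G (fin_ord n) \<subseteq> ppower p G (fin_ord m)" for m
  proof (cases "n \<le> m")
    case False
    then have "fin_ord m \<le> (fin_ord n :: 'a ordinal)"
      by (simp add: strict_mono_less_eq[OF fin_ord_strict_mono])
    then show ?thesis by (rule antimonoD[OF ppower_antimono])
  next
    case True
    then show ?thesis using ppower_fin_ord_stationary[OF assms True] by blast
  qed
  then show "ppower p G (fin_ord n) \<subseteq> ppower p G omega" by (auto simp: ppower_omega)
qed

section \<open>Socles\<close>

lemma sigma_summableE:
  assumes "sigma_summable p C"
  obtains S \<alpha> where "\<And>n. subgroup (S n) C" "\<And>n. S n \<subseteq> socle p C" "\<And>n. S n \<subseteq> S (Suc n)"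
    "socle p C = (\<Union>n. S n)"
    "\<And>n. \<alpha> n < ulm_length p C" "\<And>n. S n \<inter> ppower p C (\<alpha> n) = {\<one>\<^bsub>C\<^esub>}"
proof -
  obtain S where S: "\<forall>n. subgroup (S n) C \<and> S n \<subseteq> socle p C \<and> S n \<subseteq> S (Suc n)"
    "socle p C = (\<Union>n. S n)"
    and ex: "\<forall>n. \<exists>\<alpha> < ulm_length p C. S n \<inter> ppower p C \<alpha> = {\<one>\<^bsub>C\<^esub>}"
    using assms unfolding sigma_summable_def by (elim exE conjE)
  from ex obtain \<alpha> where "\<forall>n. \<alpha> n < ulm_length p C \<and> S n \<inter> ppower p C (\<alpha> n) = {\<one>\<^bsub>C\<^esub>}"
    unfolding choice_iff by (elim exE)
  with S show thesis using that[of S \<alpha>] by simp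
qed

lemma (in comm_group) socle_subgroup: "subgroup (socle p G) G"
  by (rule subgroupI) (auto simp: socle_def nat_pow_distrib nat_pow_inv intro: exI[of _ \<one>])

context p_torsion_group
begin

lemma ppower_fin_ord: "ppower p G (fin_ord n) = mults n"
proof (induction n)
  case (Suc n)
  have "(\<lambda>g. g [^] p) ` mults n = (\<lambda>g. (g [^] (int p ^ n)) [^] p) ` carrier G"
    by (simp add: mults_def image_image)
  also have "\<dots> = mults (Suc n)"
    unfolding mults_def
    by (rule image_cong) (simp_all add: int_pow_pow mult.commute flip: int_pow_int)
  finally show ?case using Suc by (simp add: fin_ord_Suc ppower_succ)
qed (simp add: ppower_zero mults_def)

lemma socle_alt: "socle p G = {g \<in> carrier G. g [^] int p = \<one>}"
  by (simp add: socle_def int_pow_int)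

lemma deepest_multiple_in_socle:
  assumes "x \<in> carrier G" "expo x = Suc j"
  shows "x [^] (int p ^ j) \<in> socle p G" "x [^] (int p ^ j) \<noteq> \<one>"
proof -
  have "(x [^] (int p ^ j)) [^] int p = \<one>"
    using assms expo_le_iff[of x "Suc j"] by (simp add: int_pow_pow mult.commute)
  then show "x [^] (int p ^ j) \<in> socle p G" using assms by (simp add: socle_alt)
  show "x [^] (int p ^ j) \<noteq> \<one>" using assms expo_le_iff[of x j] by simp
qed

text \<open>Induction on the exponent of x in p^m G. If it is j+1, then p^j x is a socle element of
  p^m G, so p^j x = p^(j+m+1) y for some y; subtracting p^(m+1) y stays in p^m G and lowers the
  exponent.\<close>

lemma mults_stationary_if_socle_deep:
  assumes "\<And>n. mults m \<inter> socle p G \<subseteq> mults n"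
  shows "mults m = mults (Suc m)"
proof
  have "\<forall>x\<in>mults m. expo x \<le> j \<longrightarrow> x \<in> mults (Suc m)" for j
  proof (induction j)
    case 0
    show ?case
    proof (intro ballI impI)
      fix x assume x: "x \<in> mults m" "expo x \<le> 0"
      then have "x = \<one>"
        using expo_le_iff[of x 0] subgroup.mem_carrier[OF mults_subgroup] by auto
      then show "x \<in> mults (Suc m)" using subgroup.one_closed[OF mults_subgroup] by simp
    qed
  next
    case (Suc j)
    show ?case
    proof (intro ballI impI)
      fix x assume x: "x \<in> mults m" "expo x \<le> Suc j"
      have xc: "x \<in> carrier G" using x subgroup.mem_carrier[OF mults_subgroup] by blast
      show "x \<in> mults (Suc m)"
      proof (cases "expo x = Suc j")
        case True
        have "x [^] (int p ^ j) \<in> mults (j + Suc m)"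
          using deepest_multiple_in_socle[OF xc True] assms subgroup_int_pow_closed[OF mults_subgroup x(1)] by blast
        then obtain y where y: "y \<in> carrier G" "x [^] (int p ^ j) = y [^] (int p ^ (j + Suc m))"
          by (auto simp: mults_def)
        define z where "z = y [^] (int p ^ Suc m)"
        have z: "z \<in> mults (Suc m)" "z \<in> carrier G" using y by (auto simp: z_def mults_def)
        have "z \<in> mults m" using z mults_antimono[of m "Suc m"] by auto
        have zj: "z [^] (int p ^ j) = x [^] (int p ^ j)"
          unfolding y(2) z_def using y(1) by (simp only: int_pow_pow power_add mult.commute)
        then have "expo (x \<otimes> inv z) \<le> j"
          using xc z by (simp add: expo_le_iff int_pow_distrib int_pow_inv)
        moreover have "x \<otimes> inv z \<in> mults m"
          using x \<open>z \<in> mults m\<close> subgroup.m_closed[OF mults_subgroup] subgroup.m_inv_closed[OF mults_subgroup] by simp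
        ultimately have "x \<otimes> inv z \<in> mults (Suc m)" using Suc by blast
        then have "(x \<otimes> inv z) \<otimes> z \<in> mults (Suc m)" using z subgroup.m_closed[OF mults_subgroup] by blast
        then show ?thesis using xc z by (simp add: m_assoc)
      next
        case False
        then show ?thesis using x Suc by auto
      qed
    qed
  qed
  then show "mults m \<subseteq> mults (Suc m)" by blast
  show "mults (Suc m) \<subseteq> mults m" by (rule mults_antimono) simp
qed

text \<open>A stationary finite stage makes the length finite, and it is not 0 because some ordinal
  lies below it; say it is k+1. Every \<alpha>(n) is then at most k, so p^k G meets the socle
  trivially. Hence p^k G = 0 and the length is at most k, a contradiction.\<close>

lemma sigma_summable_not_stationary:
  assumes "sigma_summable p G"
  shows "ppower p G (fin_ord n) \<noteq> ppower p G (osucc (fin_ord n))"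
proof
  assume "ppower p G (fin_ord n) = ppower p G (osucc (fin_ord n))"
  then have "ulm_length p G \<le> fin_ord n" unfolding ulm_length_def by (rule Least_le)
  then obtain m where m: "ulm_length p G = fin_ord m" using le_fin_ordD by blast
  obtain S \<alpha> where "\<And>n. subgroup (S n) G" "\<And>n. S n \<subseteq> socle p G" "\<And>n. S n \<subseteq> S (Suc n)"
    and U: "socle p G = (\<Union>n. S n)"
    and \<alpha>: "\<And>n. \<alpha> n < ulm_length p G" "\<And>n. S n \<inter> ppower p G (\<alpha> n) = {\<one>}"
    by (rule sigma_summableE[OF assms]) (rule that)
  have "ulm_length p G \<noteq> 0" using \<alpha>(1)[of 0] ordinal_zero_le[of "\<alpha> 0"] by auto
  then obtain k where k: "m = Suc k" using m by (cases m) auto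
  have triv: "x = \<one>" if x: "x \<in> socle p G" "x \<in> mults k" for x
  proof -
    obtain n where "x \<in> S n" using U x by blast
    have "\<alpha> n \<le> fin_ord k" using \<alpha>(1)[of n] m k by (simp add: fin_ord_Suc less_osucc_iff)
    then have "ppower p G (fin_ord k) \<subseteq> ppower p G (\<alpha> n)"
      by (rule antimonoD[OF ppower_antimono])
    then have "x \<in> ppower p G (\<alpha> n)" using x(2) by (auto simp: ppower_fin_ord)
    then show ?thesis using \<alpha>(2)[of n] \<open>x \<in> S n\<close> by auto
  qed
  have "mults k = {\<one>}"
  proof
    show "mults k \<subseteq> {\<one>}"
    proof
      fix x assume x: "x \<in> mults k"
      have xc: "x \<in> carrier G" using x subgroup.mem_carrier[OF mults_subgroup] by blast
      have "expo x = 0"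
      proof (cases "expo x")
        case (Suc j)
        then show ?thesis
          using triv deepest_multiple_in_socle[OF xc Suc] subgroup_int_pow_closed[OF mults_subgroup x] by blast
      qed
      then show "x \<in> {\<one>}" using expo_le_iff[OF xc, of 0] xc by simp
    qed
  qed (use subgroup.one_closed[OF mults_subgroup] in auto)
  then have "ppower p G (fin_ord k) = ppower p G (osucc (fin_ord k))"
    by (simp add: ppower_succ ppower_fin_ord)
  then have "ulm_length p G \<le> fin_ord k" unfolding ulm_length_def by (rule Least_le)
  then show False by (simp add: m k fin_ord_Suc osucc_le_iff)
qed

text \<open>The socle is a vector space over the field with p elements. By Zorn's lemma K is taken
  maximal among its subgroups meeting W trivially; a socle element outside W + K could still be
  adjoined to K.\<close>

lemma ex_socle_complement:
  assumes W: "subgroup W G" "W \<subseteq> socle p G"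
  obtains K where "subgroup K G" "K \<subseteq> socle p G" "K \<inter> W = {\<one>}" "socle p G \<subseteq> W <#> K"
proof -
  define A where "A = {K. subgroup K G \<and> K \<subseteq> socle p G \<and> K \<inter> W = {\<one>}}"
  have "\<exists>K\<in>A. \<forall>K'\<in>A. K \<subseteq> K' \<longrightarrow> K' = K"
  proof (rule subset_Zorn_nonempty)
    have "{\<one>} \<in> A" using subgroup.one_closed[OF socle_subgroup] subgroup.one_closed[OF W(1)]
      by (auto simp: A_def triv_subgroup)
    then show "A \<noteq> {}" by blast
  next
    fix C assume C: "C \<noteq> {}" "subset.chain A C"
    have CA: "C \<subseteq> A" using C by (simp add: subset_chain_def)
    have sub: "subgroup H G" if "H \<in> C" for H using that CA by (auto simp: A_def)
    have "subgroup (\<Union>C) G"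
    proof (rule subgroupI)
      show "\<Union>C \<subseteq> carrier G" using subgroup.subset[OF sub] by (rule Union_least)
      show "\<Union>C \<noteq> {}" using C(1) subgroup.one_closed[OF sub] by auto
      fix a assume "a \<in> \<Union>C"
      then show "inv a \<in> \<Union>C" using subgroup.m_inv_closed[OF sub] by auto
      fix b assume "b \<in> \<Union>C"
      obtain H where "H \<in> C" "{a, b} \<subseteq> H"
        using finite_subset_Union_chain[of "{a, b}" C A] \<open>a \<in> \<Union>C\<close> \<open>b \<in> \<Union>C\<close> C by auto
      then show "a \<otimes> b \<in> \<Union>C" using subgroup.m_closed[OF sub] by auto
    qed
    moreover have "\<Union>C \<inter> W = {\<one>}"
    proof -
      have "\<Union>C \<inter> W = (\<Union>H\<in>C. H \<inter> W)" by blast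
      also have "\<dots> = {\<one>}" using C(1) CA by (auto simp: A_def)
      finally show ?thesis .
    qed
    ultimately show "\<Union>C \<in> A" using CA by (auto simp: A_def)
  qed
  then obtain K where "K \<in> A" and maxA: "\<And>K'. K' \<in> A \<Longrightarrow> K \<subseteq> K' \<Longrightarrow> K' = K"
    by (elim bexE) simp
  then have K: "subgroup K G" "K \<subseteq> socle p G" "K \<inter> W = {\<one>}" by (simp_all add: A_def)
  have max: "K' = K" if "subgroup K' G" "K' \<subseteq> socle p G" "K' \<inter> W = {\<one>}" "K \<subseteq> K'" for K'
    using maxA[of K'] that by (simp add: A_def)
  have WK: "subgroup (W <#> K) G" by (rule mult_subgroups[OF W(1) K(1)])
  have "v \<in> W <#> K" if v: "v \<in> socle p G" for v
  proof (rule ccontr)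
    assume nv: "v \<notin> W <#> K"
    have vc: "v \<in> carrier G" "v [^] int p = \<one>" using v by (auto simp: socle_alt)
    define Z where "Z = range (\<lambda>j :: int. v [^] j)"
    have Z: "subgroup Z G" "Z \<subseteq> socle p G" "v \<in> Z"
    proof -
      show "subgroup Z G" unfolding Z_def by (rule subgroup_of_powers[OF vc(1)])
      show "Z \<subseteq> socle p G" unfolding Z_def using subgroup_int_pow_closed[OF socle_subgroup v] by blast
      show "v \<in> Z" unfolding Z_def using vc(1) by (intro range_eqI[of _ _ 1]) simp
    qed
    have KZ: "subgroup (K <#> Z) G" by (rule mult_subgroups[OF K(1) Z(1)])
    have "x = \<one>" if "x \<in> K <#> Z" "x \<in> W" for x
    proof -
      obtain k j where kj: "k \<in> K" "x = k \<otimes> v [^] (j :: int)"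
        using \<open>x \<in> K <#> Z\<close> by (auto simp: set_mult_def Z_def)
      have kc: "k \<in> carrier G" and xc: "x \<in> carrier G"
        using kj(1) \<open>x \<in> W\<close> K(1) W(1) subgroup.mem_carrier by fast+
      have "v [^] j = x \<otimes> inv k" using kj(2) kc vc(1) by (simp add: m_comm m_assoc inv_solve_left)
      then have "v [^] j \<in> W <#> K"
        using \<open>x \<in> W\<close> subgroup.m_inv_closed[OF K(1) kj(1)] by (auto simp: set_mult_def)
      \<comment> \<open>If p did not divide j, then jv and pv = 0, both in W + K, would force v into
        W + K.\<close>
      have "int p dvd j"
      proof (rule ccontr)
        assume "\<not> int p dvd j"
        moreover have "v [^] (int p ^ 1) \<in> W <#> K" using vc(2) subgroup.one_closed[OF WK] by simp
        ultimately have "v [^] (int p ^ 0) \<in> W <#> K"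
          using pow_p_coprime[OF WK vc(1), of 1 j 0] \<open>v [^] j \<in> W <#> K\<close> by simp
        then show False using nv vc(1) by simp
      qed
      then obtain r where "j = int p * r" by (elim dvdE)
      then have "v [^] j = \<one>" using vc int_pow_pow[OF vc(1), of "int p" r] by simp
      then have "x = k" using kj(2) kc by simp
      then show ?thesis using kj(1) \<open>x \<in> W\<close> K(3) by blast
    qed
    then have "(K <#> Z) \<inter> W = {\<one>}"
      using subgroup.one_closed[OF KZ] subgroup.one_closed[OF W(1)] by blast
    moreover have "K <#> Z \<subseteq> socle p G"
      using K(2) Z(2) by (auto simp: set_mult_def subset_iff intro!: subgroup.m_closed[OF socle_subgroup])
    moreover have "K \<subseteq> K <#> Z" by (rule subset_set_mult[OF K(1) Z(1)])
    ultimately have "K <#> Z = K" by (intro max KZ)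
    moreover have "v \<in> K <#> Z" using Z(3) subset_set_mult(2)[OF K(1) Z(1)] by blast
    ultimately have "v \<in> W <#> K" using subset_set_mult(2)[OF W(1) K(1)] by blast
    then show False using nv by simp
  qed
  then have "socle p G \<subseteq> W <#> K" ..
  with K that show thesis by simp
qed

end

section \<open>Transfer between a group and its large subgroups\<close>

context p_torsion_group
begin

lemma p_torsion_subgroup: "p_torsion_group (G\<lparr>carrier := L\<rparr>) p" if L: "subgroup L G"
proof -
  interpret L: comm_group "G\<lparr>carrier := L\<rparr>"
    using subgroup.mem_carrier[OF L]
    by (intro group.group_comm_groupI[OF subgroup.subgroup_is_group[OF L is_group]]) (simp add: m_comm)
  show ?thesis
    using p_torsion subgroup.mem_carrier[OF L] prime_p
    by unfold_locales (auto simp: nat_pow_consistent[symmetric])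
qed

lemma socle_sub: "socle p (G\<lparr>carrier := L\<rparr>) = socle p G \<inter> L" if "subgroup L G"
  using subgroup.subset[OF that] by (auto simp: socle_def nat_pow_consistent[symmetric])

lemma ppower_sub_subset: "ppower p (G\<lparr>carrier := L\<rparr>) x \<subseteq> ppower p G x" if L: "subgroup L G"
proof (induction x rule: less_induct)
  case (less x)
  show ?case
  proof (cases x rule: ordinal_cases)
    case 1
    then show ?thesis using subgroup.subset[OF L] by (simp add: ppower_zero)
  next
    case (2 y)
    then have "ppower p (G\<lparr>carrier := L\<rparr>) y \<subseteq> ppower p G y" using less osucc_greater by blast
    then show ?thesis by (auto simp: 2 ppower_succ nat_pow_consistent[symmetric])
  next
    case 3
    then show ?thesis using less by (auto simp: ppower_limit)
  qed
qed

section \<open>Consequences of Pierce's condition, stated as \<open>deep\<close>\<close>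

context
  fixes L :: "'a set"
  assumes L: "subgroup L G"
    and deep: "\<And>k. \<exists>m. \<forall>x\<in>mults m. x [^] (int p ^ k) = \<one> \<longrightarrow> x \<in> L"
begin

lemma mults_sub: "p_torsion_group.mults (G\<lparr>carrier := L\<rparr>) p n = (\<lambda>g. g [^] (int p ^ n)) ` L"
  using L by (simp add: p_torsion_group.mults_def[OF p_torsion_subgroup[OF L]] int_pow_consistent)

text \<open>For x in p^\<omega> G write x = p^n y with y in p^m G. The order of y divides p^(n +
  \<open>expo x\<close>), so y lies in L once m is taken from Pierce's condition for that exponent,
  and x is in p^n L.\<close>

lemma ppower_omega_sub: "ppower p (G\<lparr>carrier := L\<rparr>) omega = ppower p G omega"
proof
  interpret L: p_torsion_group "G\<lparr>carrier := L\<rparr>" p by (rule p_torsion_subgroup[OF L])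
  show "ppower p (G\<lparr>carrier := L\<rparr>) omega \<subseteq> ppower p G omega" by (rule ppower_sub_subset[OF L])
  show "ppower p G omega \<subseteq> ppower p (G\<lparr>carrier := L\<rparr>) omega"
  proof
    fix x assume x: "x \<in> ppower p G omega"
    have xm: "x \<in> mults n" for n
      using x by (auto simp: ppower_omega ppower_fin_ord)
    have xc: "x \<in> carrier G" using xm subgroup.mem_carrier[OF mults_subgroup] by blast
    have "x \<in> L.mults n" for n
    proof -
      obtain m where m: "\<And>y. y \<in> mults m \<Longrightarrow> y [^] (int p ^ (n + expo x)) = \<one> \<Longrightarrow> y \<in> L"
        using deep by blast
      obtain g where g: "g \<in> carrier G" "x = g [^] (int p ^ (m + n))" using xm by (auto simp: mults_def)
      define y where "y = g [^] (int p ^ m)"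
      have y: "y \<in> mults m" "y \<in> carrier G" "x = y [^] (int p ^ n)"
        using g by (auto simp: y_def mults_def int_pow_pow power_add)
      have "y [^] (int p ^ (n + expo x)) = x [^] (int p ^ expo x)"
        using y(2) by (simp add: y(3) int_pow_pow power_add)
      also have "\<dots> = \<one>" using pow_eq_one_iff[OF xc] by simp
      finally have "y \<in> L" using m y(1) by blast
      then show ?thesis using y(3) by (auto simp: mults_sub)
    qed
    then show "x \<in> ppower p (G\<lparr>carrier := L\<rparr>) omega" by (simp add: ppower_omega L.ppower_fin_ord)
  qed
qed

text \<open>Transfinite induction starting at \<omega>, where both sequences agree. At limits the
  stages below \<omega> are covered because they contain the stage \<omega>.\<close>

lemma ppower_sub_eq: "ppower p (G\<lparr>carrier := L\<rparr>) x = ppower p G x" if "omega \<le> x"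
  using that
proof (induction x rule: less_induct)
  case (less x)
  interpret L: p_torsion_group "G\<lparr>carrier := L\<rparr>" p by (rule p_torsion_subgroup[OF L])
  show ?case
  proof (cases "x = omega")
    case True
    then show ?thesis by (simp add: ppower_omega_sub)
  next
    case False
    then have x: "omega < x" using less.prems by simp
    show ?thesis
    proof (cases x rule: ordinal_cases)
      case 1
      then have False using x by (metis leD ordinal_zero_le)
      then show ?thesis ..
    next
      case (2 y)
      then have "omega \<le> y" using x by (simp add: less_osucc_iff)
      then have "ppower p (G\<lparr>carrier := L\<rparr>) y = ppower p G y" using less.IH 2 osucc_greater by blast
      then show ?thesis by (simp add: 2 ppower_succ nat_pow_consistent[symmetric])
    next
      case 3
      show ?thesis
      proof
        show "ppower p (G\<lparr>carrier := L\<rparr>) x \<subseteq> ppower p G x" by (rule ppower_sub_subset[OF L])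
        show "ppower p G x \<subseteq> ppower p (G\<lparr>carrier := L\<rparr>) x"
        proof
          fix z assume z: "z \<in> ppower p G x"
          have "z \<in> ppower p (G\<lparr>carrier := L\<rparr>) y" if y: "y < x" for y
          proof (cases "omega \<le> y")
            case True
            then show ?thesis using less.IH[OF y] z y by (auto simp: ppower_limit[OF 3])
          next
            case False
            then have "ppower p (G\<lparr>carrier := L\<rparr>) omega \<subseteq> ppower p (G\<lparr>carrier := L\<rparr>) y"
              by (intro antimonoD[OF L.ppower_antimono]) simp
            moreover have "z \<in> ppower p (G\<lparr>carrier := L\<rparr>) omega"
              using z x by (auto simp: ppower_omega_sub ppower_limit[OF 3])
            ultimately show ?thesis by blast
          qed
          then show "z \<in> ppower p (G\<lparr>carrier := L\<rparr>) x" by (simp add: ppower_limit[OF 3])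
        qed
      qed
    qed
  qed
qed

text \<open>Pierce's condition is applied with k = n+1: a socle element of p^(m+n) G is p^n y with y
  in p^m G and p^(n+1) y = 0, so y lies in L.\<close>

lemma deep_socle_fin_ord:
  "\<exists>m. mults m \<inter> socle p G \<subseteq> ppower p (G\<lparr>carrier := L\<rparr>) (fin_ord n)"
proof -
  interpret L: p_torsion_group "G\<lparr>carrier := L\<rparr>" p by (rule p_torsion_subgroup[OF L])
  obtain m where m: "\<And>y. y \<in> mults m \<Longrightarrow> y [^] (int p ^ Suc n) = \<one> \<Longrightarrow> y \<in> L"
    using deep by blast
  have "x \<in> L.mults n" if x: "x \<in> mults (m + n)" "x \<in> socle p G" for x
  proof -
    obtain g where g: "g \<in> carrier G" "x = g [^] (int p ^ (m + n))" using x by (auto simp: mults_def)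
    define y where "y = g [^] (int p ^ m)"
    have y: "y \<in> mults m" "y \<in> carrier G" "x = y [^] (int p ^ n)"
      using g by (auto simp: y_def mults_def int_pow_pow power_add)
    have "y [^] (int p ^ Suc n) = x [^] int p"
      using y(2) by (simp add: y(3) int_pow_pow mult.commute)
    also have "\<dots> = \<one>" using x(2) by (simp add: socle_alt)
    finally have "y \<in> L" using m y(1) by blast
    then show ?thesis using y(3) by (auto simp: mults_sub)
  qed
  then show ?thesis by (auto simp: L.ppower_fin_ord intro!: exI[of _ "m + n"])
qed

text \<open>If p^n L is stationary it equals p^\<omega> G, so the socle of some p^m G has infinite
  height and p^m G is stationary. Conversely, a stationary p^n G equals p^\<omega> L, which squeezes
  p^n L into p^(n+1) L.\<close>

lemma stationary_sub_iff:
  "(\<exists>n. ppower p (G\<lparr>carrier := L\<rparr>) (fin_ord n) = ppower p (G\<lparr>carrier := L\<rparr>) (osucc (fin_ord n)))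
    \<longleftrightarrow> (\<exists>n. ppower p G (fin_ord n) = ppower p G (osucc (fin_ord n)))"
proof
  interpret L: p_torsion_group "G\<lparr>carrier := L\<rparr>" p by (rule p_torsion_subgroup[OF L])
  assume "\<exists>n. ppower p (G\<lparr>carrier := L\<rparr>) (fin_ord n) = ppower p (G\<lparr>carrier := L\<rparr>) (osucc (fin_ord n))"
  then obtain n where n: "ppower p (G\<lparr>carrier := L\<rparr>) (fin_ord n) = ppower p (G\<lparr>carrier := L\<rparr>) (osucc (fin_ord n))" ..
  obtain m where m: "mults m \<inter> socle p G \<subseteq> ppower p (G\<lparr>carrier := L\<rparr>) (fin_ord n)"
    using deep_socle_fin_ord by blast
  have "ppower p (G\<lparr>carrier := L\<rparr>) (fin_ord n) = ppower p G omega"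
    using L.ppower_stationary_omega[OF n] ppower_omega_sub by simp
  also have "\<dots> = (\<Inter>j. mults j)" by (simp add: ppower_omega ppower_fin_ord)
  finally have "mults m = mults (Suc m)" using m by (intro mults_stationary_if_socle_deep) auto
  then show "\<exists>n. ppower p G (fin_ord n) = ppower p G (osucc (fin_ord n))"
    by (intro exI[of _ m]) (simp add: ppower_fin_ord flip: fin_ord_Suc)
next
  interpret L: p_torsion_group "G\<lparr>carrier := L\<rparr>" p by (rule p_torsion_subgroup[OF L])
  assume "\<exists>n. ppower p G (fin_ord n) = ppower p G (osucc (fin_ord n))"
  then obtain n where n: "ppower p G (fin_ord n) = ppower p G (osucc (fin_ord n))" ..
  have "ppower p (G\<lparr>carrier := L\<rparr>) (fin_ord n) \<subseteq> ppower p G (fin_ord n)" by (rule ppower_sub_subset[OF L])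
  also have "\<dots> = ppower p (G\<lparr>carrier := L\<rparr>) omega"
    using ppower_stationary_omega[OF n] ppower_omega_sub by simp
  also have "\<dots> \<subseteq> ppower p (G\<lparr>carrier := L\<rparr>) (osucc (fin_ord n))"
    unfolding fin_ord_Suc[symmetric] by (auto simp: ppower_omega)
  finally have "ppower p (G\<lparr>carrier := L\<rparr>) (fin_ord n) = ppower p (G\<lparr>carrier := L\<rparr>) (osucc (fin_ord n))"
    using antimonoD[OF L.ppower_antimono less_imp_le[OF osucc_greater]] by (rule equalityI)
  then show "\<exists>n. ppower p (G\<lparr>carrier := L\<rparr>) (fin_ord n) = ppower p (G\<lparr>carrier := L\<rparr>) (osucc (fin_ord n))" ..
qed

text \<open>From \<omega> on the two sequences coincide, and below \<omega> neither becomes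
  stationary.\<close>

lemma ulm_length_sub:
  assumes "\<And>n. ppower p G (fin_ord n) \<noteq> ppower p G (osucc (fin_ord n))"
  shows "ulm_length p (G\<lparr>carrier := L\<rparr>) = ulm_length p G"
proof -
  have "ppower p (G\<lparr>carrier := L\<rparr>) x = ppower p (G\<lparr>carrier := L\<rparr>) (osucc x)
      \<longleftrightarrow> ppower p G x = ppower p G (osucc x)" for x
  proof (cases "omega \<le> x")
    case True
    then have "omega \<le> osucc x" using osucc_greater[of x] by (metis less_imp_le order_trans)
    with True show ?thesis by (simp add: ppower_sub_eq)
  next
    case False
    then obtain n where "x = fin_ord n" using less_omegaD[of x] by (auto simp: not_le)
    then show ?thesis using assms stationary_sub_iff by blast
  qed
  then show ?thesis by (simp add: ulm_length_def)
qed

lemma fin_ord_less_ulm_length: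
  assumes "\<And>n. ppower p G (fin_ord n) \<noteq> ppower p G (osucc (fin_ord n))"
  shows "fin_ord n < ulm_length p G"
proof (rule ccontr)
  assume "\<not> ?thesis"
  then obtain m where "ulm_length p G = fin_ord m" using le_fin_ordD[of "ulm_length p G" n] by (auto simp: not_less)
  then show False using ppower_ulm_length assms by metis
qed

lemma sigma_summable_sub_iff: "sigma_summable p G \<longleftrightarrow> sigma_summable p (G\<lparr>carrier := L\<rparr>)"
proof
  assume G: "sigma_summable p G"
  then have ns: "ppower p G (fin_ord n) \<noteq> ppower p G (osucc (fin_ord n))" for n
    by (rule sigma_summable_not_stationary)
  obtain S \<alpha> where S: "\<And>n. subgroup (S n) G" "\<And>n. S n \<subseteq> socle p G" "\<And>n. S n \<subseteq> S (Suc n)"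
    "socle p G = (\<Union>n. S n)" "\<And>n. \<alpha> n < ulm_length p G" "\<And>n. S n \<inter> ppower p G (\<alpha> n) = {\<one>}"
    by (rule sigma_summableE[OF G]) (rule that)
  interpret L: p_torsion_group "G\<lparr>carrier := L\<rparr>" p by (rule p_torsion_subgroup[OF L])
  show "sigma_summable p (G\<lparr>carrier := L\<rparr>)"
    unfolding sigma_summable_def
  proof (intro exI[of _ "\<lambda>n. S n \<inter> L"] conjI allI)
    fix n
    have "subgroup (S n \<inter> L) G" by (rule subgroups_Inter_pair[OF S(1) L])
    then show "subgroup (S n \<inter> L) (G\<lparr>carrier := L\<rparr>)" using L by (rule subgroup_incl) simp
    show "S n \<inter> L \<subseteq> socle p (G\<lparr>carrier := L\<rparr>)" using S(2)[of n] by (auto simp: socle_sub[OF L])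
    show "S n \<inter> L \<subseteq> S (Suc n) \<inter> L" using S(3)[of n] by auto
    have "S n \<inter> L \<inter> ppower p (G\<lparr>carrier := L\<rparr>) (\<alpha> n) \<subseteq> {\<one>}"
      using S(6)[of n] ppower_sub_subset[OF L, of "\<alpha> n"] by auto
    moreover have "\<one> \<in> S n \<inter> L \<inter> ppower p (G\<lparr>carrier := L\<rparr>) (\<alpha> n)"
      using subgroup.one_closed[OF S(1)] subgroup.one_closed[OF L] subgroup.one_closed[OF L.ppower_subgroup] by simp
    ultimately have "S n \<inter> L \<inter> ppower p (G\<lparr>carrier := L\<rparr>) (\<alpha> n) = {\<one>}" by blast
    then show "\<exists>\<alpha><ulm_length p (G\<lparr>carrier := L\<rparr>). S n \<inter> L \<inter> ppower p (G\<lparr>carrier := L\<rparr>) \<alpha> = {\<one>\<^bsub>G\<lparr>carrier := L\<rparr>\<^esub>}"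
      using S(5)[of n] by (intro exI[of _ "\<alpha> n"]) (simp add: ulm_length_sub[OF ns])
  qed (auto simp: socle_sub[OF L] S(4))
next
  interpret L: p_torsion_group "G\<lparr>carrier := L\<rparr>" p by (rule p_torsion_subgroup[OF L])
  assume GL: "sigma_summable p (G\<lparr>carrier := L\<rparr>)"
  have ns: "ppower p G (fin_ord n) \<noteq> ppower p G (osucc (fin_ord n))" for n
    using L.sigma_summable_not_stationary[OF GL] stationary_sub_iff by blast
  note len = fin_ord_less_ulm_length[OF ns]
  obtain T \<alpha> where T: "\<And>n. subgroup (T n) (G\<lparr>carrier := L\<rparr>)" "\<And>n. T n \<subseteq> socle p (G\<lparr>carrier := L\<rparr>)"
    "\<And>n. T n \<subseteq> T (Suc n)" "socle p (G\<lparr>carrier := L\<rparr>) = (\<Union>n. T n)"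
    "\<And>n. \<alpha> n < ulm_length p (G\<lparr>carrier := L\<rparr>)"
    "\<And>n. T n \<inter> ppower p (G\<lparr>carrier := L\<rparr>) (\<alpha> n) = {\<one>\<^bsub>G\<lparr>carrier := L\<rparr>\<^esub>}"
    by (rule sigma_summableE[OF GL]) (rule that)
  have TG: "subgroup (T n) G" for n by (rule incl_subgroup[OF L T(1)])
  obtain m where m: "mults m \<inter> socle p G \<subseteq> L"
    using deep_socle_fin_ord[of 0] by (auto simp: ppower_zero)
  define W where "W = mults m \<inter> socle p G"
  have W: "subgroup W G" "W \<subseteq> socle p G"
    unfolding W_def by (auto intro: subgroups_Inter_pair mults_subgroup socle_subgroup)
  obtain K where K: "subgroup K G" "K \<subseteq> socle p G" "K \<inter> W = {\<one>}" "socle p G \<subseteq> W <#> K"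
    using W by (rule ex_socle_complement)
  \<comment> \<open>K supplies the socle elements missing from W. Cutting T(n) down to W keeps the
    sum with K direct.\<close>
  define S where "S n = (T n \<inter> W) <#> K" for n
  have S: "subgroup (S n) G" for n
    unfolding S_def by (intro mult_subgroups subgroups_Inter_pair TG W K)
  have Ssoc: "S n \<subseteq> socle p G" for n
    using W(2) K(2) by (auto simp: S_def set_mult_def intro!: subgroup.m_closed[OF socle_subgroup])
  show "sigma_summable p G"
    unfolding sigma_summable_def
  proof (intro exI[of _ S] conjI allI S Ssoc)
    show "S n \<subseteq> S (Suc n)" for n
      using T(3)[of n] by (auto simp: S_def set_mult_def)
    show "socle p G = (\<Union>n. S n)"
    proof
      show "(\<Union>n. S n) \<subseteq> socle p G" using Ssoc by blast
      show "socle p G \<subseteq> (\<Union>n. S n)"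
      proof
        fix v assume "v \<in> socle p G"
        then obtain w k where wk: "w \<in> W" "k \<in> K" "v = w \<otimes> k" using K(4) by (auto simp: set_mult_def)
        have "w \<in> (\<Union>n. T n)" unfolding T(4)[symmetric] using wk(1) m by (auto simp: socle_sub[OF L] W_def)
        then show "v \<in> (\<Union>n. S n)" using wk by (auto simp: S_def set_mult_def)
      qed
    qed
    fix n
    \<comment> \<open>An infinite \<alpha>(n) serves as its own \<beta>; a finite one is replaced by
      a possibly larger finite ordinal, which is still below the length.\<close>
    have "\<exists>\<beta><ulm_length p G. ppower p G \<beta> \<inter> socle p G \<subseteq> ppower p (G\<lparr>carrier := L\<rparr>) (\<alpha> n)"
    proof (cases "omega \<le> \<alpha> n")
      case True
      then show ?thesis using T(5)[of n] by (intro exI[of _ "\<alpha> n"]) (auto simp: ppower_sub_eq ulm_length_sub[OF ns])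
    next
      case False
      then obtain j where j: "\<alpha> n = fin_ord j" using less_omegaD[of "\<alpha> n"] by (auto simp: not_le)
      obtain i where "mults i \<inter> socle p G \<subseteq> ppower p (G\<lparr>carrier := L\<rparr>) (fin_ord j)"
        using deep_socle_fin_ord by blast
      then show ?thesis using len[of i] j by (intro exI[of _ "fin_ord i"]) (auto simp: ppower_fin_ord)
    qed
    then obtain \<beta> where \<beta>: "\<beta> < ulm_length p G"
      "ppower p G \<beta> \<inter> socle p G \<subseteq> ppower p (G\<lparr>carrier := L\<rparr>) (\<alpha> n)" by blast
    \<comment> \<open>Going at least to stage m places the socle elements concerned in W.\<close>
    let ?\<beta> = "max \<beta> (fin_ord m)"
    have sub: "ppower p G ?\<beta> \<subseteq> ppower p G \<beta>" "ppower p G ?\<beta> \<subseteq> mults m"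
      using antimonoD[OF ppower_antimono[of p], of \<beta> ?\<beta>] antimonoD[OF ppower_antimono[of p], of "fin_ord m" ?\<beta>]
      by (simp_all add: ppower_fin_ord)
    have "v = \<one>" if v: "v \<in> S n" "v \<in> ppower p G ?\<beta>" for v
    proof -
      obtain t k where tk: "t \<in> T n" "t \<in> W" "k \<in> K" "v = t \<otimes> k" using v(1) by (auto simp: S_def set_mult_def)
      have car: "t \<in> carrier G" "k \<in> carrier G"
        using subgroup.mem_carrier[OF W(1) tk(2)] subgroup.mem_carrier[OF K(1) tk(3)] .
      have vs: "v \<in> socle p G" using v(1) Ssoc by blast
      then have "v \<in> W" using v(2) sub(2) by (auto simp: W_def)
      \<comment> \<open>Both v and t lie in W, so the K-component of v lies in W as well and
        vanishes; v is then in T(n).\<close>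
      then have "inv t \<otimes> v \<in> W" using subgroup.m_closed[OF W(1)] subgroup.m_inv_closed[OF W(1) tk(2)] by blast
      moreover have "inv t \<otimes> v = k" using tk(4) car by (simp add: m_assoc[symmetric])
      ultimately have "k = \<one>" using tk(3) K(3) by auto
      then have "v \<in> T n" using tk car by simp
      moreover have "v \<in> ppower p (G\<lparr>carrier := L\<rparr>) (\<alpha> n)" using \<beta>(2) sub(1) v(2) vs by blast
      ultimately show ?thesis using T(6)[of n] by auto
    qed
    then have "S n \<inter> ppower p G ?\<beta> = {\<one>}"
      using subgroup.one_closed[OF S] subgroup.one_closed[OF ppower_subgroup] by blast
    then show "\<exists>\<alpha><ulm_length p G. S n \<inter> ppower p G \<alpha> = {\<one>}"
      using \<beta>(1) len[of m] by (intro exI[of _ ?\<beta>]) simp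
  qed
qed

end

end

theorem theorem6:
  fixes p :: nat and G :: "('a, 'm) monoid_scheme" and L :: "'a set"
  assumes "Factorial_Ring.prime p" and "abelian_p_group p G" and "large_subgroup L G"
  shows "sigma_summable p G \<longleftrightarrow> sigma_summable p (G\<lparr>carrier := L\<rparr>)"
proof -
  interpret comm_group G using assms(2) by (simp add: abelian_p_group_def)
  interpret p_torsion_group G p
    using assms(1,2) by unfold_locales (auto simp: abelian_p_group_def)
  have "subgroup L G" using assms(3) by (simp add: large_subgroup_def fully_invariant_def)
  moreover have "\<exists>m. \<forall>x\<in>mults m. x [^]\<^bsub>G\<^esub> (int p ^ k) = \<one>\<^bsub>G\<^esub> \<longrightarrow> x \<in> L" for k
    using large_subgroup_contains_deep[OF assms(3)] by metis
  ultimately show ?thesis by (rule sigma_summable_sub_iff)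
qed

end
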